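(* Let $\mathcal{A}$ be an abelian category and let $\mathcal{C}$ be a subcategory of $\mathcal{A}$ such that $\mathcal{C}\perp\mathcal{C}$ and $\mathcal{P}(\mathcal{A})$ is a generator for $\mathcal{C}$. Then: (1) $\mathrm{SPC}(\mathcal{G}(\mathcal{C}))$ is closed under extensions. (2) $\mathrm{SPC}(\mathcal{G}(\mathcal{C}))$ is closed under $\mathcal{C}$-stable direct summands.
   Context: All subcategories of the abelian category $\mathcal{A}$ are full, additive and closed under isomorphisms. $\mathcal{P}(\mathcal{A})$ is the subcategory of projective objects of $\mathcal{A}$. For subcategories $\mathcal{X},\mathcal{Y}$ of $\mathcal{A}$, $\mathcal{X}\perp\mathcal{Y}$ means $\mathrm{Ext}^{i}_{\mathcal{A}}(X,Y)=0$ for all $i\geq 1$, $X\in\mathcal{X}$, $Y\in\mathcal{Y}$. For subcategories $\mathcal{X}\subseteq\mathcal{T}$ of $\mathcal{A}$, $\mathcal{X}$ is a generator for $\mathcal{T}$ if for every $T\in\mathcal{T}$ there is an exact sequence $0\to T'\to X\to T\to 0$ in $\mathcal{A}$ with $X\in\mathcal{X}$ and $T'\in\mathcal{T}$ (in particular, $\mathcal{P}(\mathcal{A})$ being a generator for $\mathcal{C}$ includes $\mathcal{P}(\mathcal{A})\subseteq\mathcal{C}$). A sequence in $\mathcal{A}$ is $\mathrm{Hom}_{\mathcal{A}}(\mathcal{X},-)$-exact (resp. $\mathrm{Hom}_{\mathcal{A}}(-,\mathcal{X})$-exact) if it is exact after applying $\mathrm{Hom}_{\mathcal{A}}(X,-)$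 (resp. $\mathrm{Hom}_{\mathcal{A}}(-,X)$) for every $X\in\mathcal{X}$. The Gorenstein subcategory $\mathcal{G}(\mathcal{C})$ consists of the objects $M$ of $\mathcal{A}$ for which there is an exact sequence $\cdots\to C_1\to C_0\to C^0\to C^1\to\cdots$ in $\mathcal{A}$ with all terms in $\mathcal{C}$, which is both $\mathrm{Hom}_{\mathcal{A}}(\mathcal{C},-)$-exact and $\mathrm{Hom}_{\mathcal{A}}(-,\mathcal{C})$-exact, such that $M\cong\mathrm{Im}(C_0\to C^0)$. $\mathcal{X}^{\perp_1}:=\{M\in\mathcal{A}\mid \mathrm{Ext}^1_{\mathcal{A}}(X,M)=0 \text{ for all } X\in\mathcal{X}\}$. A morphism $f:X\to Y$ with $X\in\mathcal{X}$ is an $\mathcal{X}$-precover of $Y$ if $\mathrm{Hom}_{\mathcal{A}}(X',f)$ is surjective for all $X'\in\mathcal{X}$; it is special if moreover $f$ is an epimorphism and $\mathrm{Ker}\,f\in\mathcal{X}^{\perp_1}$. $\mathrm{SPC}(\mathcal{G}(\mathcal{C}))$ is the subcategory of $\mathcal{A}$ consisting of the objects admitting a special $\mathcal{G}(\mathcal{C})$-precover. A subcategory $\mathcal{X}$ of $\mathcal{A}$ is closed under $\mathcal{C}$-stable direct summands if $X\oplus C\in\mathcal{X}$ with $C\in\mathcal{C}$ implies $X\in\mathcal{X}$. *)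

theory Defs
  imports "HOL-Algebra.Coset"
begin

text \<open>
  Abelian categories as carrier-based records, in the style of HOL-Algebra. Composition is
  written in applicative order: \<open>g \<cdot> f\<close> is \<open>g\<close> after \<open>f\<close>. Operations are only
  meaningful on composable (respectively parallel) morphisms between objects of \<open>Ob\<close>.
\<close>

record ('o, 'm) precat =
  Ob :: "'o set"
  Mor :: "'m set"
  Dom :: "'m \<Rightarrow> 'o"
  Cod :: "'m \<Rightarrow> 'o"
  Ident :: "'o \<Rightarrow> 'm"
  Comp :: "'m \<Rightarrow> 'm \<Rightarrow> 'm" (infixl "\<cdot>\<index>" 70)
  Plus :: "'m \<Rightarrow> 'm \<Rightarrow> 'm" (infixl "\<boxplus>\<index>" 65)
  Zero :: "'o \<Rightarrow> 'o \<Rightarrow> 'm"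

definition Hom :: "('o, 'm, 'z) precat_scheme \<Rightarrow> 'o \<Rightarrow> 'o \<Rightarrow> 'm set" where
  "Hom A X Y = {f \<in> Mor A. Dom A f = X \<and> Cod A f = Y}"

definition Hom_group :: "('o, 'm, 'z) precat_scheme \<Rightarrow> 'o \<Rightarrow> 'o \<Rightarrow> 'm monoid" where
  "Hom_group A X Y = \<lparr>carrier = Hom A X Y, mult = Plus A, one = Zero A X Y\<rparr>"

locale category =
  fixes A :: "('o, 'm, 'z) precat_scheme" (structure)
  assumes Dom_closed: "f \<in> Mor A \<Longrightarrow> Dom A f \<in> Ob A"
    and Cod_closed: "f \<in> Mor A \<Longrightarrow> Cod A f \<in> Ob A"
    and Ident_closed: "X \<in> Ob A \<Longrightarrow> Ident A X \<in> Hom A X X"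
    and Comp_closed: "f \<in> Hom A X Y \<Longrightarrow> g \<in> Hom A Y Z \<Longrightarrow> g \<cdot> f \<in> Hom A X Z"
    and Ident_left: "f \<in> Hom A X Y \<Longrightarrow> Ident A Y \<cdot> f = f"
    and Ident_right: "f \<in> Hom A X Y \<Longrightarrow> f \<cdot> Ident A X = f"
    and Comp_assoc: "f \<in> Hom A W X \<Longrightarrow> g \<in> Hom A X Y \<Longrightarrow> h \<in> Hom A Y Z \<Longrightarrow>
      (h \<cdot> g) \<cdot> f = h \<cdot> (g \<cdot> f)"

locale preadditive_category = category +
  assumes Hom_comm_group: "X \<in> Ob A \<Longrightarrow> Y \<in> Ob A \<Longrightarrow> comm_group (Hom_group A X Y)"
    and Comp_Plus_right: "f \<in> Hom A X Y \<Longrightarrow> g \<in> Hom A X Y \<Longrightarrow> h \<in> Hom A Y Z \<Longrightarrow>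
      h \<cdot> (f \<boxplus> g) = (h \<cdot> f) \<boxplus> (h \<cdot> g)"
    and Comp_Plus_left: "f \<in> Hom A X Y \<Longrightarrow> g \<in> Hom A Y Z \<Longrightarrow> h \<in> Hom A Y Z \<Longrightarrow>
      (g \<boxplus> h) \<cdot> f = (g \<cdot> f) \<boxplus> (h \<cdot> f)"

definition monic :: "('o, 'm, 'z) precat_scheme \<Rightarrow> 'm \<Rightarrow> bool" where
  "monic A f \<longleftrightarrow> f \<in> Mor A \<and>
    (\<forall>W. \<forall>u \<in> Hom A W (Dom A f). \<forall>v \<in> Hom A W (Dom A f). f \<cdot>\<^bsub>A\<^esub> u = f \<cdot>\<^bsub>A\<^esub> v \<longrightarrow> u = v)"

definition epic :: "('o, 'm, 'z) precat_scheme \<Rightarrow> 'm \<Rightarrow> bool" where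
  "epic A f \<longleftrightarrow> f \<in> Mor A \<and>
    (\<forall>W. \<forall>u \<in> Hom A (Cod A f) W. \<forall>v \<in> Hom A (Cod A f) W. u \<cdot>\<^bsub>A\<^esub> f = v \<cdot>\<^bsub>A\<^esub> f \<longrightarrow> u = v)"

definition isomorphic :: "('o, 'm, 'z) precat_scheme \<Rightarrow> 'o \<Rightarrow> 'o \<Rightarrow> bool" where
  "isomorphic A X Y \<longleftrightarrow> X \<in> Ob A \<and> Y \<in> Ob A \<and>
    (\<exists>f \<in> Hom A X Y. \<exists>g \<in> Hom A Y X. g \<cdot>\<^bsub>A\<^esub> f = Ident A X \<and> f \<cdot>\<^bsub>A\<^esub> g = Ident A Y)"

definition zero_object :: "('o, 'm, 'z) precat_scheme \<Rightarrow> 'o \<Rightarrow> bool" where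
  "zero_object A Z \<longleftrightarrow> Z \<in> Ob A \<and>
    (\<forall>X \<in> Ob A. (\<exists>!f. f \<in> Hom A X Z) \<and> (\<exists>!f. f \<in> Hom A Z X))"

definition biproduct :: "('o, 'm, 'z) precat_scheme \<Rightarrow> 'o \<Rightarrow> 'o \<Rightarrow> 'o \<Rightarrow> bool" where
  "biproduct A X Y S \<longleftrightarrow> X \<in> Ob A \<and> Y \<in> Ob A \<and> S \<in> Ob A \<and>
    (\<exists>i1 \<in> Hom A X S. \<exists>i2 \<in> Hom A Y S. \<exists>p1 \<in> Hom A S X. \<exists>p2 \<in> Hom A S Y.
      p1 \<cdot>\<^bsub>A\<^esub> i1 = Ident A X \<and> p2 \<cdot>\<^bsub>A\<^esub> i2 = Ident A Y \<and>
      p2 \<cdot>\<^bsub>A\<^esub> i1 = Zero A X Y \<and> p1 \<cdot>\<^bsub>A\<^esub> i2 = Zero A Y X \<and>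
      (i1 \<cdot>\<^bsub>A\<^esub> p1) \<boxplus>\<^bsub>A\<^esub> (i2 \<cdot>\<^bsub>A\<^esub> p2) = Ident A S)"

text \<open>Kernels, cokernels and images are morphisms, determined up to isomorphism only.\<close>

definition is_kernel :: "('o, 'm, 'z) precat_scheme \<Rightarrow> 'm \<Rightarrow> 'm \<Rightarrow> bool" where
  "is_kernel A k f \<longleftrightarrow> k \<in> Mor A \<and> f \<in> Mor A \<and> Cod A k = Dom A f \<and>
    f \<cdot>\<^bsub>A\<^esub> k = Zero A (Dom A k) (Cod A f) \<and>
    (\<forall>W. \<forall>u \<in> Hom A W (Dom A f). f \<cdot>\<^bsub>A\<^esub> u = Zero A W (Cod A f) \<longrightarrow>
      (\<exists>!h. h \<in> Hom A W (Dom A k) \<and> k \<cdot>\<^bsub>A\<^esub> h = u))"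

definition is_cokernel :: "('o, 'm, 'z) precat_scheme \<Rightarrow> 'm \<Rightarrow> 'm \<Rightarrow> bool" where
  "is_cokernel A c f \<longleftrightarrow> c \<in> Mor A \<and> f \<in> Mor A \<and> Dom A c = Cod A f \<and>
    c \<cdot>\<^bsub>A\<^esub> f = Zero A (Dom A f) (Cod A c) \<and>
    (\<forall>W. \<forall>u \<in> Hom A (Cod A f) W. u \<cdot>\<^bsub>A\<^esub> f = Zero A (Dom A f) W \<longrightarrow>
      (\<exists>!h. h \<in> Hom A (Cod A c) W \<and> h \<cdot>\<^bsub>A\<^esub> c = u))"

definition is_image :: "('o, 'm, 'z) precat_scheme \<Rightarrow> 'm \<Rightarrow> 'm \<Rightarrow> bool" where
  "is_image A m f \<longleftrightarrow> (\<exists>c. is_cokernel A c f \<and> is_kernel A m c)"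

locale abelian_category = preadditive_category +
  assumes zero_object_exists: "\<exists>Z. zero_object A Z"
    and biproduct_exists: "X \<in> Ob A \<Longrightarrow> Y \<in> Ob A \<Longrightarrow> \<exists>S. biproduct A X Y S"
    and kernel_exists: "f \<in> Mor A \<Longrightarrow> \<exists>k. is_kernel A k f"
    and cokernel_exists: "f \<in> Mor A \<Longrightarrow> \<exists>c. is_cokernel A c f"
    and monic_normal: "monic A f \<Longrightarrow> \<exists>g. is_kernel A f g"
    and epic_conormal: "epic A f \<Longrightarrow> \<exists>g. is_cokernel A f g"

text \<open>Exactness of \<open>X \<rightarrow> Y \<rightarrow> Z\<close> at \<open>Y\<close>: \<open>Im f = Ker g\<close> as subobjects of \<open>Y\<close>.\<close>

definition exact :: "('o, 'm, 'z) precat_scheme \<Rightarrow> 'm \<Rightarrow> 'm \<Rightarrow> bool" where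
  "exact A f g \<longleftrightarrow> f \<in> Mor A \<and> g \<in> Mor A \<and> Cod A f = Dom A g \<and>
    (\<exists>m. is_image A m f \<and> is_kernel A m g)"

definition short_exact :: "('o, 'm, 'z) precat_scheme \<Rightarrow> 'm \<Rightarrow> 'm \<Rightarrow> bool" where
  "short_exact A f g \<longleftrightarrow> monic A f \<and> exact A f g \<and> epic A g"

text \<open>
  A full subcategory is given by its set of objects. It is additive if it contains a zero
  object and is closed under (binary) direct sums.
\<close>

definition subcategory :: "('o, 'm, 'z) precat_scheme \<Rightarrow> 'o set \<Rightarrow> bool" where
  "subcategory A \<X> \<longleftrightarrow> \<X> \<subseteq> Ob A \<and>
    (\<forall>X Y. X \<in> \<X> \<longrightarrow> isomorphic A X Y \<longrightarrow> Y \<in> \<X>) \<and>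
    (\<exists>Z \<in> \<X>. zero_object A Z) \<and>
    (\<forall>X Y S. X \<in> \<X> \<longrightarrow> Y \<in> \<X> \<longrightarrow> biproduct A X Y S \<longrightarrow> S \<in> \<X>)"

definition projectives :: "('o, 'm, 'z) precat_scheme \<Rightarrow> 'o set" where
  "projectives A = {P \<in> Ob A. \<forall>f. epic A f \<longrightarrow>
    (\<forall>u \<in> Hom A P (Cod A f). \<exists>h \<in> Hom A P (Dom A f). f \<cdot>\<^bsub>A\<^esub> h = u)}"

definition generator :: "('o, 'm, 'z) precat_scheme \<Rightarrow> 'o set \<Rightarrow> 'o set \<Rightarrow> bool" where
  "generator A \<X> \<T> \<longleftrightarrow> \<X> \<subseteq> \<T> \<and>
    (\<forall>T \<in> \<T>. \<exists>f g. short_exact A f g \<and> Cod A g = T \<and> Dom A g \<in> \<X> \<and> Dom A f \<in> \<T>)"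

text \<open>
  Yoneda Ext; no projective or injective resolutions are assumed to exist. For \<open>n \<ge> 1\<close>, the
  \<open>n\<close>-fold extension \<open>0 \<rightarrow> Y \<rightarrow> E\<^sub>1 \<rightarrow> \<dots> \<rightarrow> E\<^sub>n \<rightarrow> X \<rightarrow> 0\<close> of \<open>X\<close> by \<open>Y\<close> is the list of its
  \<open>n + 1\<close> morphisms, and its terms are numbered \<open>E\<^sub>0 = Y, E\<^sub>1, \<dots>, E\<^sub>n, E\<^sub>n\<^sub>+\<^sub>1 = X\<close>.
\<close>

definition extensions :: "('o, 'm, 'z) precat_scheme \<Rightarrow> nat \<Rightarrow> 'o \<Rightarrow> 'o \<Rightarrow> 'm list set" where
  "extensions A n X Y = {ds. length ds = Suc n \<and> Dom A (hd ds) = Y \<and> Cod A (last ds) = X \<and>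
    monic A (hd ds) \<and> epic A (last ds) \<and> (\<forall>i < n. exact A (ds ! i) (ds ! Suc i))}"

definition extension_term :: "('o, 'm, 'z) precat_scheme \<Rightarrow> 'm list \<Rightarrow> nat \<Rightarrow> 'o" where
  "extension_term A ds i = (if i < length ds then Dom A (ds ! i) else Cod A (last ds))"

definition extension_morphism ::
  "('o, 'm, 'z) precat_scheme \<Rightarrow> nat \<Rightarrow> 'o \<Rightarrow> 'o \<Rightarrow> 'm list \<Rightarrow> 'm list \<Rightarrow> (nat \<Rightarrow> 'm) \<Rightarrow> bool" where
  "extension_morphism A n X Y ds es h \<longleftrightarrow>
    (\<forall>i \<le> Suc n. h i \<in> Hom A (extension_term A ds i) (extension_term A es i)) \<and>
    h 0 = Ident A Y \<and> h (Suc n) = Ident A X \<and>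
    (\<forall>i \<le> n. h (Suc i) \<cdot>\<^bsub>A\<^esub> (ds ! i) = (es ! i) \<cdot>\<^bsub>A\<^esub> h i)"

definition Yoneda_rel ::
  "('o, 'm, 'z) precat_scheme \<Rightarrow> nat \<Rightarrow> 'o \<Rightarrow> 'o \<Rightarrow> ('m list \<times> 'm list) set" where
  "Yoneda_rel A n X Y = {(ds, es). ds \<in> extensions A n X Y \<and> es \<in> extensions A n X Y \<and>
    (\<exists>h. extension_morphism A n X Y ds es h)}"

definition Yoneda_equiv ::
  "('o, 'm, 'z) precat_scheme \<Rightarrow> nat \<Rightarrow> 'o \<Rightarrow> 'o \<Rightarrow> ('m list \<times> 'm list) set" where
  "Yoneda_equiv A n X Y = Restr ((Yoneda_rel A n X Y \<union> (Yoneda_rel A n X Y)\<inverse>)\<^sup>*) (extensions A n X Y)"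

definition Ext :: "('o, 'm, 'z) precat_scheme \<Rightarrow> nat \<Rightarrow> 'o \<Rightarrow> 'o \<Rightarrow> 'm list set set" where
  "Ext A n X Y = extensions A n X Y // Yoneda_equiv A n X Y"

lemma equiv_Yoneda_equiv: "equiv (extensions A n X Y) (Yoneda_equiv A n X Y)"
proof (rule equivI)
  have "sym ((Yoneda_rel A n X Y \<union> (Yoneda_rel A n X Y)\<inverse>)\<^sup>*)"
    by (intro sym_rtrancl sym_Un_converse)
  then show "sym (Yoneda_equiv A n X Y)"
    unfolding Yoneda_equiv_def sym_def by blast
  show "trans (Yoneda_equiv A n X Y)"
    unfolding Yoneda_equiv_def trans_def by (blast intro: rtrancl_trans)
qed (auto simp: Yoneda_equiv_def refl_on_def)

text \<open>
  \<open>Ext A n X Y\<close> is the underlying set of the Yoneda Ext group (under Baer sum) for \<open>n \<ge> 1\<close>.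
  A group is zero iff it has exactly one element, so the addition need not be defined.
\<close>

definition Ext_vanishes :: "('o, 'm, 'z) precat_scheme \<Rightarrow> nat \<Rightarrow> 'o \<Rightarrow> 'o \<Rightarrow> bool" where
  "Ext_vanishes A n X Y \<longleftrightarrow> is_singleton (Ext A n X Y)"

definition Ext_orthogonal :: "('o, 'm, 'z) precat_scheme \<Rightarrow> 'o set \<Rightarrow> 'o set \<Rightarrow> bool" where
  "Ext_orthogonal A \<X> \<Y> \<longleftrightarrow> (\<forall>i \<ge> 1. \<forall>X \<in> \<X>. \<forall>Y \<in> \<Y>. Ext_vanishes A i X Y)"

definition right_Ext1_perp :: "('o, 'm, 'z) precat_scheme \<Rightarrow> 'o set \<Rightarrow> 'o set" where
  "right_Ext1_perp A \<X> = {M \<in> Ob A. \<forall>X \<in> \<X>. Ext_vanishes A 1 X M}"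

definition Hom_from_exact :: "('o, 'm, 'z) precat_scheme \<Rightarrow> 'o set \<Rightarrow> 'm \<Rightarrow> 'm \<Rightarrow> bool" where
  "Hom_from_exact A \<X> f g \<longleftrightarrow> (\<forall>X \<in> \<X>.
    (\<lambda>u. f \<cdot>\<^bsub>A\<^esub> u) ` Hom A X (Dom A f) =
    kernel (Hom_group A X (Dom A g)) (Hom_group A X (Cod A g)) (\<lambda>u. g \<cdot>\<^bsub>A\<^esub> u))"

definition Hom_to_exact :: "('o, 'm, 'z) precat_scheme \<Rightarrow> 'o set \<Rightarrow> 'm \<Rightarrow> 'm \<Rightarrow> bool" where
  "Hom_to_exact A \<X> f g \<longleftrightarrow> (\<forall>X \<in> \<X>.
    (\<lambda>u. u \<cdot>\<^bsub>A\<^esub> g) ` Hom A (Cod A g) X =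
    kernel (Hom_group A (Cod A f) X) (Hom_group A (Dom A f) X) (\<lambda>u. u \<cdot>\<^bsub>A\<^esub> f))"

text \<open>
  The complete resolution is indexed by the integers: \<open>K n\<close> is \<open>C\<^sub>n\<close> for \<open>n \<ge> 0\<close> and
  \<open>K (- 1 - n)\<close> is the term with upper index \<open>n\<close>, so \<open>d 0\<close> is the middle map \<open>C\<^sub>0 \<rightarrow> C\<^sup>0\<close>.
\<close>

definition Gorenstein :: "('o, 'm, 'z) precat_scheme \<Rightarrow> 'o set \<Rightarrow> 'o set" where
  "Gorenstein A \<C> = {M \<in> Ob A. \<exists>(K :: int \<Rightarrow> 'o) (d :: int \<Rightarrow> 'm).
    (\<forall>n. K n \<in> \<C> \<and> d n \<in> Hom A (K n) (K (n - 1)) \<and>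
      exact A (d (n + 1)) (d n) \<and>
      Hom_from_exact A \<C> (d (n + 1)) (d n) \<and>
      Hom_to_exact A \<C> (d (n + 1)) (d n)) \<and>
    (\<exists>m. is_image A m (d 0) \<and> isomorphic A M (Dom A m))}"

definition precover :: "('o, 'm, 'z) precat_scheme \<Rightarrow> 'o set \<Rightarrow> 'm \<Rightarrow> 'o \<Rightarrow> bool" where
  "precover A \<X> f Y \<longleftrightarrow> f \<in> Mor A \<and> Cod A f = Y \<and> Dom A f \<in> \<X> \<and>
    (\<forall>X' \<in> \<X>. (\<lambda>u. f \<cdot>\<^bsub>A\<^esub> u) ` Hom A X' (Dom A f) = Hom A X' Y)"

definition special_precover :: "('o, 'm, 'z) precat_scheme \<Rightarrow> 'o set \<Rightarrow> 'm \<Rightarrow> 'o \<Rightarrow> bool" where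
  "special_precover A \<X> f Y \<longleftrightarrow> precover A \<X> f Y \<and> epic A f \<and>
    (\<exists>k. is_kernel A k f \<and> Dom A k \<in> right_Ext1_perp A \<X>)"

definition SPC :: "('o, 'm, 'z) precat_scheme \<Rightarrow> 'o set \<Rightarrow> 'o set" where
  "SPC A \<X> = {M \<in> Ob A. \<exists>f. special_precover A \<X> f M}"

definition closed_under_extensions :: "('o, 'm, 'z) precat_scheme \<Rightarrow> 'o set \<Rightarrow> bool" where
  "closed_under_extensions A \<X> \<longleftrightarrow> (\<forall>f g. short_exact A f g \<longrightarrow>
    Dom A f \<in> \<X> \<longrightarrow> Cod A g \<in> \<X> \<longrightarrow> Cod A f \<in> \<X>)"

definition closed_under_stable_summands ::
  "('o, 'm, 'z) precat_scheme \<Rightarrow> 'o set \<Rightarrow> 'o set \<Rightarrow> bool" where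
  "closed_under_stable_summands A \<C> \<X> \<longleftrightarrow>
    (\<forall>X C S. C \<in> \<C> \<longrightarrow> biproduct A X C S \<longrightarrow> S \<in> \<X> \<longrightarrow> X \<in> \<X>)"

end

theory Submission
  imports Defs
begin

text \<open>
  Only Ext in degree one matters, in the form that every extension splits. A class of objects is
  totally resolved over \<open>C\<close> if its members are left and right \<open>Ext\<^sup>1\<close>-orthogonal to \<open>C\<close> and each
  member \<open>M\<close> fits into sequences \<open>0 \<rightarrow> N \<rightarrow> X \<rightarrow> M \<rightarrow> 0\<close> and \<open>0 \<rightarrow> M \<rightarrow> X' \<rightarrow> N' \<rightarrow> 0\<close> with \<open>X\<close>, \<open>X'\<close> in \<open>C\<close> and
  \<open>N\<close>, \<open>N'\<close> members. Splicing shows that the Gorenstein subcategory is the largest totally resolved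
  class, so it is closed under extensions (horseshoe lemma) and under \<open>C\<close>-stable summands.

  For an extension \<open>0 \<rightarrow> X \<rightarrow> Y \<rightarrow> Z \<rightarrow> 0\<close> with special precovers of \<open>X\<close> and \<open>Z\<close> by \<open>GX\<close> and \<open>GZ\<close>, the usual
  obstruction in \<open>Ext\<^sup>2\<close> vanishes by dimension shifting: since projectives generate \<open>C\<close>, there is a
  sequence \<open>0 \<rightarrow> N \<rightarrow> P \<rightarrow> GZ \<rightarrow> 0\<close> with \<open>P\<close> projective and \<open>N\<close> Gorenstein. The map \<open>P \<rightarrow> GZ \<rightarrow> Z\<close> lifts to \<open>Y\<close>, the
  induced map \<open>N \<rightarrow> X\<close> lifts to \<open>GX\<close>, and the pushout of \<open>P\<close> along \<open>N \<rightarrow> GX\<close> is a Gorenstein object \<open>E\<close>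
  mapping onto \<open>Y\<close>, whose kernel is an extension of the two given kernels.
\<close>

section \<open>Calculating with morphisms\<close>

context category
begin

text \<open>
  Listing the two objects, although redundant, keeps their membership in \<open>Ob\<close> available to the
  simplifier after \<open>Dom\<close> and \<open>Cod\<close> have been rewritten.
\<close>

lemma Hom_iff [simp]:
  "f \<in> Hom A X Y \<longleftrightarrow> f \<in> Mor A \<and> Dom A f = X \<and> Cod A f = Y \<and> X \<in> Ob A \<and> Y \<in> Ob A"
  using Dom_closed Cod_closed by (auto simp: Hom_def)

lemma Comp_typing [simp]:
  assumes "f \<in> Mor A" "g \<in> Mor A" "Cod A f = Dom A g"
  shows "g \<cdot> f \<in> Mor A" "Dom A (g \<cdot> f) = Dom A f" "Cod A (g \<cdot> f) = Cod A g"
  using Comp_closed[of f "Dom A f" "Dom A g" g "Cod A g"] assms Dom_closed Cod_closed by auto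

lemma Ident_typing [simp]:
  assumes "X \<in> Ob A"
  shows "Ident A X \<in> Mor A" "Dom A (Ident A X) = X" "Cod A (Ident A X) = X"
  using Ident_closed[OF assms] by auto

lemma Ident_comp [simp]: "f \<in> Mor A \<Longrightarrow> Cod A f = Y \<Longrightarrow> Ident A Y \<cdot> f = f"
  using Ident_left[of f "Dom A f" Y] Dom_closed Cod_closed by auto

lemma comp_Ident [simp]: "f \<in> Mor A \<Longrightarrow> Dom A f = X \<Longrightarrow> f \<cdot> Ident A X = f"
  using Ident_right[of f X "Cod A f"] Dom_closed Cod_closed by auto

lemma assoc:
  assumes "f \<in> Mor A" "g \<in> Mor A" "h \<in> Mor A" "Cod A f = Dom A g" "Cod A g = Dom A h"
  shows "(h \<cdot> g) \<cdot> f = h \<cdot> (g \<cdot> f)"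
  using Comp_assoc[of f "Dom A f" "Dom A g" g "Dom A h" h "Cod A h"] assms Dom_closed Cod_closed
  by auto

text \<open>Composites are normalised with brackets to the right, where the factor
  \<open>g \<cdot> f\<close> is no longer visible as a subterm. This form applies an equation for it
  there.\<close>

lemma comp_cong_left:
  assumes "g \<cdot> f = h" "x \<in> Mor A" "f \<in> Mor A" "g \<in> Mor A" "Cod A x = Dom A f" "Cod A f = Dom A g"
  shows "g \<cdot> (f \<cdot> x) = h \<cdot> x"
  using assoc[of x f g] assms by simp

lemma monicD:
  assumes "monic A f" "f \<cdot> u = f \<cdot> v" "u \<in> Mor A" "v \<in> Mor A" "Dom A u = Dom A v"
    "Cod A u = Dom A f" "Cod A v = Dom A f"
  shows "u = v"
proof -
  have "u \<in> Hom A (Dom A u) (Dom A f)" "v \<in> Hom A (Dom A u) (Dom A f)"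
    using assms Dom_closed Cod_closed unfolding monic_def by auto
  then show ?thesis using assms(1,2) unfolding monic_def by blast
qed

lemma epicD:
  assumes "epic A f" "u \<cdot> f = v \<cdot> f" "u \<in> Mor A" "v \<in> Mor A" "Cod A u = Cod A v"
    "Dom A u = Cod A f" "Dom A v = Cod A f"
  shows "u = v"
proof -
  have "u \<in> Hom A (Cod A f) (Cod A u)" "v \<in> Hom A (Cod A f) (Cod A u)"
    using assms Dom_closed Cod_closed unfolding epic_def by auto
  then show ?thesis using assms(1,2) unfolding epic_def by blast
qed

end

text \<open>The record carries no negation, so it is taken from the Hom group whose two objects are
  read off \<open>f\<close>.\<close>

definition Neg :: "('o, 'm, 'z) precat_scheme \<Rightarrow> 'm \<Rightarrow> 'm" where
  "Neg A f = inv\<^bsub>Hom_group A (Dom A f) (Cod A f)\<^esub> f"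

context preadditive_category
begin

section \<open>Groups of morphisms and bilinearity of composition\<close>

lemma Hom_group_simps [simp]:
  "carrier (Hom_group A X Y) = Hom A X Y" "mult (Hom_group A X Y) = Plus A"
  "one (Hom_group A X Y) = Zero A X Y"
  by (simp_all add: Hom_group_def)

lemma Zero_typing [simp]:
  assumes "X \<in> Ob A" "Y \<in> Ob A"
  shows "Zero A X Y \<in> Mor A" "Dom A (Zero A X Y) = X" "Cod A (Zero A X Y) = Y"
proof -
  interpret G: comm_group "Hom_group A X Y" using Hom_comm_group assms by blast
  have "Zero A X Y \<in> Hom A X Y" using G.one_closed by (simp del: Hom_iff)
  then show "Zero A X Y \<in> Mor A" "Dom A (Zero A X Y) = X" "Cod A (Zero A X Y) = Y" by auto
qed

lemma Plus_typing [simp]: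
  assumes "f \<in> Mor A" "g \<in> Mor A" "Dom A f = Dom A g" "Cod A f = Cod A g"
  shows "f \<boxplus> g \<in> Mor A" "Dom A (f \<boxplus> g) = Dom A g" "Cod A (f \<boxplus> g) = Cod A g"
proof -
  interpret G: comm_group "Hom_group A (Dom A g) (Cod A g)"
    using Hom_comm_group assms Dom_closed Cod_closed by blast
  have "f \<boxplus> g \<in> Hom A (Dom A g) (Cod A g)"
    using G.m_closed[of f g] assms Dom_closed Cod_closed by simp
  then show "f \<boxplus> g \<in> Mor A" "Dom A (f \<boxplus> g) = Dom A g" "Cod A (f \<boxplus> g) = Cod A g" by auto
qed

lemma Neg_typing [simp]:
  assumes "f \<in> Mor A"
  shows "Neg A f \<in> Mor A" "Dom A (Neg A f) = Dom A f" "Cod A (Neg A f) = Cod A f"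
proof -
  interpret G: comm_group "Hom_group A (Dom A f) (Cod A f)"
    using Hom_comm_group assms Dom_closed Cod_closed by blast
  have "Neg A f \<in> Hom A (Dom A f) (Cod A f)"
    unfolding Neg_def using G.inv_closed[of f] assms Dom_closed Cod_closed by simp
  then show "Neg A f \<in> Mor A" "Dom A (Neg A f) = Dom A f" "Cod A (Neg A f) = Cod A f" by auto
qed

lemma Plus_Zero [simp]:
  assumes "f \<in> Mor A" "X = Dom A f" "Y = Cod A f"
  shows "f \<boxplus> Zero A X Y = f" "Zero A X Y \<boxplus> f = f"
proof -
  interpret G: comm_group "Hom_group A (Dom A f) (Cod A f)"
    using Hom_comm_group assms Dom_closed Cod_closed by blast
  show "f \<boxplus> Zero A X Y = f" "Zero A X Y \<boxplus> f = f"
    using G.r_one[of f] G.l_one[of f] assms Dom_closed Cod_closed by auto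
qed

lemma Plus_Neg [simp]:
  assumes "f \<in> Mor A"
  shows "f \<boxplus> Neg A f = Zero A (Dom A f) (Cod A f)" "Neg A f \<boxplus> f = Zero A (Dom A f) (Cod A f)"
proof -
  interpret G: comm_group "Hom_group A (Dom A f) (Cod A f)"
    using Hom_comm_group assms Dom_closed Cod_closed by blast
  show "f \<boxplus> Neg A f = Zero A (Dom A f) (Cod A f)" "Neg A f \<boxplus> f = Zero A (Dom A f) (Cod A f)"
    unfolding Neg_def using G.r_inv[of f] G.l_inv[of f] assms Dom_closed Cod_closed by auto
qed

lemma Plus_assoc:
  assumes "f \<in> Mor A" "g \<in> Mor A" "h \<in> Mor A" "Dom A f = Dom A g" "Cod A f = Cod A g"
    "Dom A g = Dom A h" "Cod A g = Cod A h"
  shows "(f \<boxplus> g) \<boxplus> h = f \<boxplus> (g \<boxplus> h)"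
proof -
  interpret G: comm_group "Hom_group A (Dom A g) (Cod A g)"
    using Hom_comm_group assms Dom_closed Cod_closed by blast
  show ?thesis using G.m_assoc[of f g h] assms Dom_closed Cod_closed by auto
qed

lemma Plus_comm:
  assumes "f \<in> Mor A" "g \<in> Mor A" "Dom A f = Dom A g" "Cod A f = Cod A g"
  shows "f \<boxplus> g = g \<boxplus> f"
proof -
  interpret G: comm_group "Hom_group A (Dom A g) (Cod A g)"
    using Hom_comm_group assms Dom_closed Cod_closed by blast
  show ?thesis using G.m_comm[of f g] assms Dom_closed Cod_closed by auto
qed

lemma Plus_left_cancel:
  assumes "f \<boxplus> g = f \<boxplus> h" "f \<in> Mor A" "g \<in> Mor A" "h \<in> Mor A"
    "Dom A f = Dom A g" "Cod A f = Cod A g" "Dom A h = Dom A g" "Cod A h = Cod A g"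
  shows "g = h"
proof -
  interpret G: comm_group "Hom_group A (Dom A g) (Cod A g)"
    using Hom_comm_group assms Dom_closed Cod_closed by blast
  have "f \<in> Hom A (Dom A g) (Cod A g)" "g \<in> Hom A (Dom A g) (Cod A g)"
    "h \<in> Hom A (Dom A g) (Cod A g)"
    using assms Dom_closed Cod_closed by auto
  then show ?thesis using G.Units_l_cancel[of f g h] assms(1)
    unfolding G.Units_eq Hom_group_simps by blast
qed

lemma eq_if_diff_Zero:
  assumes "f \<boxplus> Neg A g = Zero A X Y" "f \<in> Mor A" "g \<in> Mor A" "Dom A f = X" "Cod A f = Y"
    "Dom A g = X" "Cod A g = Y"
  shows "f = g"
proof -
  have "Neg A g \<boxplus> f = Neg A g \<boxplus> g" using assms Plus_comm[of f "Neg A g"] by simp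
  then show ?thesis by (rule Plus_left_cancel) (use assms in simp_all)
qed

lemma distrib_left:
  assumes "f \<in> Mor A" "g \<in> Mor A" "h \<in> Mor A" "Dom A f = Dom A g" "Cod A f = Cod A g"
    "Cod A g = Dom A h"
  shows "h \<cdot> (f \<boxplus> g) = (h \<cdot> f) \<boxplus> (h \<cdot> g)"
  using Comp_Plus_right[of f "Dom A g" "Cod A g" g h "Cod A h"] assms Dom_closed Cod_closed by auto

lemma distrib_right:
  assumes "f \<in> Mor A" "g \<in> Mor A" "h \<in> Mor A" "Dom A g = Dom A h" "Cod A g = Cod A h"
    "Cod A f = Dom A h"
  shows "(g \<boxplus> h) \<cdot> f = (g \<cdot> f) \<boxplus> (h \<cdot> f)"
  using Comp_Plus_left[of f "Dom A f" "Dom A h" g "Cod A h" h] assms Dom_closed Cod_closed by auto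

text \<open>Applying \<open>h\<close> to \<open>0 + 0 = 0\<close> gives
  \<open>h 0 + h 0 = h 0\<close>, and one summand cancels.\<close>

lemma comp_Zero [simp]:
  assumes "h \<in> Mor A" "X \<in> Ob A" "Y = Dom A h"
  shows "h \<cdot> Zero A X Y = Zero A X (Cod A h)"
proof -
  have Y: "Y \<in> Ob A" "Cod A h \<in> Ob A" using assms Dom_closed Cod_closed by auto
  have "h \<cdot> (Zero A X Y \<boxplus> Zero A X Y) = (h \<cdot> Zero A X Y) \<boxplus> (h \<cdot> Zero A X Y)"
    by (rule distrib_left) (use assms Y in simp_all)
  then have "(h \<cdot> Zero A X Y) \<boxplus> (h \<cdot> Zero A X Y) = (h \<cdot> Zero A X Y) \<boxplus> Zero A X (Cod A h)"
    using assms Y by simp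
  then show ?thesis by (rule Plus_left_cancel) (use assms Y in simp_all)
qed

lemma Zero_comp [simp]:
  assumes "h \<in> Mor A" "Y \<in> Ob A" "X = Cod A h"
  shows "Zero A X Y \<cdot> h = Zero A (Dom A h) Y"
proof -
  have X: "X \<in> Ob A" "Dom A h \<in> Ob A" using assms Dom_closed Cod_closed by auto
  have "(Zero A X Y \<boxplus> Zero A X Y) \<cdot> h = (Zero A X Y \<cdot> h) \<boxplus> (Zero A X Y \<cdot> h)"
    by (rule distrib_right) (use assms X in simp_all)
  then have "(Zero A X Y \<cdot> h) \<boxplus> (Zero A X Y \<cdot> h) = (Zero A X Y \<cdot> h) \<boxplus> Zero A (Dom A h) Y"
    using assms X by simp
  then show ?thesis by (rule Plus_left_cancel) (use assms X in simp_all)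
qed

lemma comp_Neg:
  assumes "f \<in> Mor A" "h \<in> Mor A" "Cod A f = Dom A h"
  shows "h \<cdot> Neg A f = Neg A (h \<cdot> f)"
proof -
  have "(h \<cdot> f) \<boxplus> (h \<cdot> Neg A f) = h \<cdot> (f \<boxplus> Neg A f)"
    by (rule distrib_left[symmetric]) (use assms in simp_all)
  also have "\<dots> = (h \<cdot> f) \<boxplus> Neg A (h \<cdot> f)" using assms Dom_closed by simp
  finally show ?thesis by (rule Plus_left_cancel) (use assms in simp_all)
qed

lemma Neg_comp:
  assumes "f \<in> Mor A" "h \<in> Mor A" "Cod A f = Dom A h"
  shows "Neg A h \<cdot> f = Neg A (h \<cdot> f)"
proof -
  have "(h \<cdot> f) \<boxplus> (Neg A h \<cdot> f) = (h \<boxplus> Neg A h) \<cdot> f"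
    by (rule distrib_right[symmetric]) (use assms in simp_all)
  also have "\<dots> = (h \<cdot> f) \<boxplus> Neg A (h \<cdot> f)" using assms Cod_closed by simp
  finally show ?thesis by (rule Plus_left_cancel) (use assms in simp_all)
qed

lemma Neg_Zero [simp]:
  assumes "X \<in> Ob A" "Y \<in> Ob A"
  shows "Neg A (Zero A X Y) = Zero A X Y"
proof -
  have "Zero A X Y \<boxplus> Neg A (Zero A X Y) = Neg A (Zero A X Y)"
    by (rule Plus_Zero(2)) (use assms in simp_all)
  moreover have "Zero A X Y \<boxplus> Neg A (Zero A X Y) = Zero A X Y"
    using Plus_Neg(1) assms by (metis Zero_typing)
  ultimately show ?thesis by metis
qed

lemma Neg_eq_Zero:
  assumes "Neg A f = Zero A X Y" "f \<in> Mor A" "Dom A f = X" "Cod A f = Y"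
  shows "f = Zero A X Y"
proof -
  have "f \<boxplus> Zero A X Y = Zero A X Y" using Plus_Neg(1)[OF assms(2)] unfolding assms .
  then show ?thesis using Plus_Zero(1)[of f X Y] assms(2-4) by metis
qed

text \<open>By additivity it is enough to test against zero: two maps with the same composite are
  compared through their difference.\<close>

lemma monicI:
  assumes f: "f \<in> Hom A X Y"
    and inj: "\<And>W u. u \<in> Hom A W X \<Longrightarrow> f \<cdot> u = Zero A W Y \<Longrightarrow> u = Zero A W X"
  shows "monic A f"
  unfolding monic_def
proof (intro conjI allI ballI impI)
  show "f \<in> Mor A" using f by simp
  fix W u v
  assume u: "u \<in> Hom A W (Dom A f)" and v: "v \<in> Hom A W (Dom A f)" and eq: "f \<cdot> u = f \<cdot> v"
  have "f \<cdot> (u \<boxplus> Neg A v) = Zero A W Y" using f u v eq by (simp add: distrib_left comp_Neg)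
  then have "u \<boxplus> Neg A v = Zero A W X" using inj[of "u \<boxplus> Neg A v" W] f u v by simp
  then show "u = v" by (rule eq_if_diff_Zero) (use f u v in simp_all)
qed

lemma epicI:
  assumes f: "f \<in> Hom A X Y"
    and inj: "\<And>W u. u \<in> Hom A Y W \<Longrightarrow> u \<cdot> f = Zero A X W \<Longrightarrow> u = Zero A Y W"
  shows "epic A f"
  unfolding epic_def
proof (intro conjI allI ballI impI)
  show "f \<in> Mor A" using f by simp
  fix W u v
  assume u: "u \<in> Hom A (Cod A f) W" and v: "v \<in> Hom A (Cod A f) W" and eq: "u \<cdot> f = v \<cdot> f"
  have "(u \<boxplus> Neg A v) \<cdot> f = Zero A X W" using f u v eq by (simp add: distrib_right Neg_comp)
  then have "u \<boxplus> Neg A v = Zero A Y W" using inj[of "u \<boxplus> Neg A v" W] f u v by simp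
  then show "u = v" by (rule eq_if_diff_Zero) (use f u v in simp_all)
qed

lemma monic_Zero:
  assumes "monic A f" "f \<cdot> u = Zero A W Y" "u \<in> Hom A W X" "f \<in> Hom A X Y"
  shows "u = Zero A W X"
  using monicD[of f u "Zero A W X"] assms by simp

lemma epic_Zero:
  assumes "epic A f" "u \<cdot> f = Zero A X W" "u \<in> Hom A Y W" "f \<in> Hom A X Y"
  shows "u = Zero A Y W"
  using epicD[of f u "Zero A Y W"] assms by simp

end

section \<open>Duality\<close>

text \<open>\<open>Zero\<close> is indexed by source and target, so its arguments are exchanged too.
  Applying the construction twice returns \<open>A\<close> itself, which lets dualised facts be
  rewritten back into facts about \<open>A\<close>.\<close>

definition op_cat :: "('o, 'm, 'z) precat_scheme \<Rightarrow> ('o, 'm, 'z) precat_scheme" where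
  "op_cat A = A\<lparr>Dom := Cod A, Cod := Dom A, Comp := \<lambda>f g. g \<cdot>\<^bsub>A\<^esub> f, Zero := \<lambda>X Y. Zero A Y X\<rparr>"

lemma op_cat_simps [simp]:
  "Ob (op_cat A) = Ob A" "Mor (op_cat A) = Mor A" "Dom (op_cat A) = Cod A" "Cod (op_cat A) = Dom A"
  "Ident (op_cat A) = Ident A" "f \<cdot>\<^bsub>op_cat A\<^esub> g = g \<cdot>\<^bsub>A\<^esub> f" "Plus (op_cat A) = Plus A"
  "Zero (op_cat A) X Y = Zero A Y X" "op_cat (op_cat A) = A"
  by (simp_all add: op_cat_def)

lemma op_cat_Hom [simp]: "Hom (op_cat A) X Y = Hom A Y X"
  by (auto simp: Hom_def)

lemma op_cat_notions [simp]:
  "Hom_group (op_cat A) X Y = Hom_group A Y X"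
  "monic (op_cat A) f \<longleftrightarrow> epic A f" "epic (op_cat A) f \<longleftrightarrow> monic A f"
  "is_kernel (op_cat A) f g \<longleftrightarrow> is_cokernel A f g"
  "is_cokernel (op_cat A) f g \<longleftrightarrow> is_kernel A f g"
  "zero_object (op_cat A) Z \<longleftrightarrow> zero_object A Z"
  by (auto simp: Hom_group_def monic_def epic_def is_kernel_def is_cokernel_def zero_object_def)

text \<open>Naming the four structure maps makes duality visible: passing to \<open>op_cat A\<close>
  exchanges injections and projections.\<close>

definition biproduct_maps ::
  "('o, 'm, 'z) precat_scheme \<Rightarrow> 'o \<Rightarrow> 'o \<Rightarrow> 'o \<Rightarrow> 'm \<Rightarrow> 'm \<Rightarrow> 'm \<Rightarrow> 'm \<Rightarrow> bool" where
  "biproduct_maps A X Y S i1 i2 p1 p2 \<longleftrightarrow>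
    i1 \<in> Hom A X S \<and> i2 \<in> Hom A Y S \<and> p1 \<in> Hom A S X \<and> p2 \<in> Hom A S Y \<and>
    p1 \<cdot>\<^bsub>A\<^esub> i1 = Ident A X \<and> p2 \<cdot>\<^bsub>A\<^esub> i2 = Ident A Y \<and>
    p2 \<cdot>\<^bsub>A\<^esub> i1 = Zero A X Y \<and> p1 \<cdot>\<^bsub>A\<^esub> i2 = Zero A Y X \<and>
    (i1 \<cdot>\<^bsub>A\<^esub> p1) \<boxplus>\<^bsub>A\<^esub> (i2 \<cdot>\<^bsub>A\<^esub> p2) = Ident A S"

lemma biproduct_iff_maps:
  "biproduct A X Y S \<longleftrightarrow> X \<in> Ob A \<and> Y \<in> Ob A \<and> S \<in> Ob A \<and>
    (\<exists>i1 i2 p1 p2. biproduct_maps A X Y S i1 i2 p1 p2)"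
  unfolding biproduct_def biproduct_maps_def Bex_def by simp

lemma op_cat_biproduct_maps [simp]:
  "biproduct_maps (op_cat A) X Y S p1 p2 i1 i2 \<longleftrightarrow> biproduct_maps A X Y S i1 i2 p1 p2"
  unfolding biproduct_maps_def by auto

lemma op_cat_biproduct [simp]: "biproduct (op_cat A) X Y S \<longleftrightarrow> biproduct A X Y S"
  unfolding biproduct_iff_maps op_cat_simps op_cat_biproduct_maps by blast

lemma abelian_category_op_cat:
  assumes "abelian_category A"
  shows "abelian_category (op_cat A)"
proof -
  interpret abelian_category A by fact
  show ?thesis
  proof (intro abelian_category.intro preadditive_category.intro category.intro
      preadditive_category_axioms.intro abelian_category_axioms.intro)
    show "comm_group (Hom_group (op_cat A) X Y)" if "X \<in> Ob (op_cat A)" "Y \<in> Ob (op_cat A)" for X Y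
      using Hom_comm_group that by simp
    show "\<exists>Z. zero_object (op_cat A) Z" using zero_object_exists by simp
    show "\<exists>S. biproduct (op_cat A) X Y S" if "X \<in> Ob (op_cat A)" "Y \<in> Ob (op_cat A)" for X Y
      using biproduct_exists that by simp
  qed (simp_all add: kernel_exists cokernel_exists monic_normal epic_conormal assoc
      distrib_left distrib_right Dom_closed Cod_closed)
qed

text \<open>A self-dual form of short exactness. It replaces the image in \<open>short_exact\<close>
  by a kernel and a cokernel condition, and records the three objects.\<close>

definition ses :: "('o, 'm, 'z) precat_scheme \<Rightarrow> 'm \<Rightarrow> 'm \<Rightarrow> 'o \<Rightarrow> 'o \<Rightarrow> 'o \<Rightarrow> bool" where
  "ses A f g X Y Z \<longleftrightarrow> f \<in> Hom A X Y \<and> g \<in> Hom A Y Z \<and> is_kernel A f g \<and> is_cokernel A g f"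

lemma op_cat_ses [simp]: "ses (op_cat A) f g X Y Z \<longleftrightarrow> ses A g f Z Y X"
  unfolding ses_def by auto

context preadditive_category
begin

section \<open>Universal properties of kernels, cokernels and biproducts\<close>

lemma kernel_lift:
  assumes "is_kernel A k f" "f \<cdot> u = Zero A W (Cod A f)" "u \<in> Hom A W (Dom A f)"
  shows "\<exists>h \<in> Hom A W (Dom A k). k \<cdot> h = u"
  using assms unfolding is_kernel_def by blast

lemma cokernel_colift:
  assumes "is_cokernel A c f" "u \<cdot> f = Zero A (Dom A f) W" "u \<in> Hom A (Cod A f) W"
  shows "\<exists>h \<in> Hom A (Cod A c) W. h \<cdot> c = u"
  using assms unfolding is_cokernel_def by blast

lemma kernel_monic:
  assumes "is_kernel A k f"
  shows "monic A k"
proof -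
  have k: "k \<in> Hom A (Dom A k) (Dom A f)" "f \<in> Hom A (Dom A f) (Cod A f)"
    and fk: "f \<cdot> k = Zero A (Dom A k) (Cod A f)"
    and uniq: "\<And>W u. u \<in> Hom A W (Dom A f) \<Longrightarrow> f \<cdot> u = Zero A W (Cod A f) \<Longrightarrow>
      \<exists>!h. h \<in> Hom A W (Dom A k) \<and> k \<cdot> h = u"
    using assms Dom_closed Cod_closed unfolding is_kernel_def by (simp, simp, simp, blast)
  show ?thesis
  proof (rule monicI[OF k(1)])
    fix W u assume u: "u \<in> Hom A W (Dom A k)" and ku: "k \<cdot> u = Zero A W (Dom A f)"
    have "\<exists>!h. h \<in> Hom A W (Dom A k) \<and> k \<cdot> h = Zero A W (Dom A f)"
      by (rule uniq) (use k u in auto)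
    moreover have "Zero A W (Dom A k) \<in> Hom A W (Dom A k)"
      "k \<cdot> Zero A W (Dom A k) = Zero A W (Dom A f)" using k u by auto
    ultimately show "u = Zero A W (Dom A k)" using u ku by blast
  qed
qed

lemma is_kernelI:
  assumes k: "k \<in> Hom A K X" and f: "f \<in> Hom A X Y" and "monic A k" and "f \<cdot> k = Zero A K Y"
    and lift: "\<And>W u. u \<in> Hom A W X \<Longrightarrow> f \<cdot> u = Zero A W Y \<Longrightarrow> \<exists>h \<in> Hom A W K. k \<cdot> h = u"
  shows "is_kernel A k f"
  unfolding is_kernel_def
proof (intro conjI allI ballI impI)
  fix W u assume u: "u \<in> Hom A W (Dom A f)" and fu: "f \<cdot> u = Zero A W (Cod A f)"
  obtain h where h: "h \<in> Hom A W K" "k \<cdot> h = u" using lift[of u W] u fu f by auto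
  show "\<exists>!h. h \<in> Hom A W (Dom A k) \<and> k \<cdot> h = u"
  proof (rule ex1I[of _ h])
    fix h' assume "h' \<in> Hom A W (Dom A k) \<and> k \<cdot> h' = u"
    then show "h' = h" using monicD[of k h' h] \<open>monic A k\<close> h k by auto
  qed (use h k in auto)
qed (use assms in auto)

lemma biproduct_maps_typing:
  assumes "biproduct_maps A X Y S i1 i2 p1 p2"
  shows "i1 \<in> Hom A X S" "i2 \<in> Hom A Y S" "p1 \<in> Hom A S X" "p2 \<in> Hom A S Y"
  using assms unfolding biproduct_maps_def by simp_all

lemma biproduct_maps_simps:
  assumes "biproduct_maps A X Y S i1 i2 p1 p2"
  shows "p1 \<cdot> i1 = Ident A X" "p2 \<cdot> i2 = Ident A Y" "p2 \<cdot> i1 = Zero A X Y" "p1 \<cdot> i2 = Zero A Y X"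
    "(i1 \<cdot> p1) \<boxplus> (i2 \<cdot> p2) = Ident A S"
  using assms unfolding biproduct_maps_def by simp_all

text \<open>The decomposition of \<open>Ident A S\<close> recovers every map into \<open>S\<close>
  from its two components.\<close>

lemma biproduct_pair_eqI:
  assumes b: "biproduct_maps A X Y S i1 i2 p1 p2" and w: "w \<in> Hom A T S" "w' \<in> Hom A T S"
    and "p1 \<cdot> w = p1 \<cdot> w'" "p2 \<cdot> w = p2 \<cdot> w'"
  shows "w = w'"
proof -
  note t = biproduct_maps_typing[OF b]
  have "v = (i1 \<cdot> (p1 \<cdot> v)) \<boxplus> (i2 \<cdot> (p2 \<cdot> v))" if v: "v \<in> Hom A T S" for v
  proof -
    have "((i1 \<cdot> p1) \<boxplus> (i2 \<cdot> p2)) \<cdot> v = v" using biproduct_maps_simps(5)[OF b] v by simp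
    moreover have "((i1 \<cdot> p1) \<boxplus> (i2 \<cdot> p2)) \<cdot> v = (i1 \<cdot> (p1 \<cdot> v)) \<boxplus> (i2 \<cdot> (p2 \<cdot> v))"
      using t v by (simp add: distrib_right assoc)
    ultimately show ?thesis by simp
  qed
  from this[OF w(1)] this[OF w(2)] assms(4,5) show ?thesis by simp
qed

lemma biproduct_pair:
  assumes b: "biproduct_maps A X Y S i1 i2 p1 p2" and u: "u \<in> Hom A T X" and v: "v \<in> Hom A T Y"
  shows "\<exists>w \<in> Hom A T S. p1 \<cdot> w = u \<and> p2 \<cdot> w = v"
proof
  note t = biproduct_maps_typing[OF b] and s = biproduct_maps_simps[OF b]
  show "(i1 \<cdot> u) \<boxplus> (i2 \<cdot> v) \<in> Hom A T S" using t u v by simp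
  have "p1 \<cdot> (i1 \<cdot> u) = u" "p1 \<cdot> (i2 \<cdot> v) = Zero A T X"
    "p2 \<cdot> (i1 \<cdot> u) = Zero A T Y" "p2 \<cdot> (i2 \<cdot> v) = v"
    using comp_cong_left[OF s(1), of u] comp_cong_left[OF s(4), of v]
      comp_cong_left[OF s(3), of u] comp_cong_left[OF s(2), of v] t u v by simp_all
  then show "p1 \<cdot> ((i1 \<cdot> u) \<boxplus> (i2 \<cdot> v)) = u \<and> p2 \<cdot> ((i1 \<cdot> u) \<boxplus> (i2 \<cdot> v)) = v"
    using t u v by (simp add: distrib_left)
qed

end

context abelian_category
begin

lemma op_abelian: "abelian_category (op_cat A)"
  using abelian_category_op_cat abelian_category_axioms .

lemma preadditive_op: "preadditive_category (op_cat A)"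
  using op_abelian abelian_category.axioms(1) by blast

text \<open>
  A dual statement is the original one at \<open>op_cat A\<close>, with the notions of \<open>op_cat A\<close> rewritten into
  those of \<open>A\<close>.
\<close>

lemmas op_unfold = op_cat_simps op_cat_Hom op_cat_notions op_cat_biproduct_maps op_cat_biproduct op_cat_ses

lemmas cokernel_epic = preadditive_category.kernel_monic[OF preadditive_op, unfolded op_unfold]
lemmas is_cokernelI = preadditive_category.is_kernelI[OF preadditive_op, unfolded op_unfold]
lemmas biproduct_copair_eqI = preadditive_category.biproduct_pair_eqI[OF preadditive_op, unfolded op_unfold]
lemmas biproduct_copair = preadditive_category.biproduct_pair[OF preadditive_op, unfolded op_unfold]

end

section \<open>Short exact sequences\<close>

context preadditive_category
begin

lemma biproduct_maps_swap:
  assumes "biproduct_maps A X Y S i1 i2 p1 p2"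
  shows "biproduct_maps A Y X S i2 i1 p2 p1"
proof -
  have "(i2 \<cdot> p2) \<boxplus> (i1 \<cdot> p1) = (i1 \<cdot> p1) \<boxplus> (i2 \<cdot> p2)"
    using Plus_comm biproduct_maps_typing[OF assms] by simp
  then show ?thesis using assms unfolding biproduct_maps_def by simp
qed

text \<open>A map \<open>u\<close> killed by \<open>p2\<close> has the single component
  \<open>p1 \<cdot> u\<close>, so it equals \<open>i1 \<cdot> (p1 \<cdot> u)\<close>.\<close>

lemma biproduct_is_kernel:
  assumes b: "biproduct_maps A X Y S i1 i2 p1 p2"
  shows "is_kernel A i1 p2"
proof (rule is_kernelI)
  note t = biproduct_maps_typing[OF b] and s = biproduct_maps_simps[OF b]
  show "i1 \<in> Hom A X S" "p2 \<in> Hom A S Y" "p2 \<cdot> i1 = Zero A X Y" using t s by auto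
  show "monic A i1"
  proof (rule monicI[OF t(1)])
    fix W u assume u: "u \<in> Hom A W X" "i1 \<cdot> u = Zero A W S"
    then have "p1 \<cdot> (i1 \<cdot> u) = Zero A W X" using t by simp
    then show "u = Zero A W X" using comp_cong_left[OF s(1), of u] t u by simp
  qed
  fix W u assume u: "u \<in> Hom A W S" "p2 \<cdot> u = Zero A W Y"
  have "i1 \<cdot> (p1 \<cdot> u) = u"
    by (rule biproduct_pair_eqI[OF b, of _ W])
      (use comp_cong_left[OF s(1), of "p1 \<cdot> u"] comp_cong_left[OF s(3), of "p1 \<cdot> u"] t u in simp_all)
  then show "\<exists>h \<in> Hom A W X. i1 \<cdot> h = u" using t u by (intro bexI[of _ "p1 \<cdot> u"]) auto
qed

lemma is_kernel_facts:
  assumes "is_kernel A k f"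
  shows "k \<in> Hom A (Dom A k) (Dom A f)" "f \<in> Hom A (Dom A f) (Cod A f)"
    "f \<cdot> k = Zero A (Dom A k) (Cod A f)"
  using assms Dom_closed Cod_closed unfolding is_kernel_def by (simp, simp, blast)

lemma ses_facts:
  assumes "ses A f g X Y Z"
  shows "f \<in> Hom A X Y" "g \<in> Hom A Y Z" "monic A f" "g \<cdot> f = Zero A X Z" "is_kernel A f g"
    "is_cokernel A g f"
proof -
  have k: "f \<in> Hom A X Y" "g \<in> Hom A Y Z" "is_kernel A f g" "is_cokernel A g f"
    using assms unfolding ses_def by blast+
  then show "f \<in> Hom A X Y" "g \<in> Hom A Y Z" "is_kernel A f g" "is_cokernel A g f" by blast+
  show "monic A f" using kernel_monic k(3) .
  show "g \<cdot> f = Zero A X Z" using k(1,2) is_kernel_facts(3)[OF k(3)] by simp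
qed

lemma ses_lift:
  assumes "ses A f g X Y Z" "u \<in> Hom A W Y" "g \<cdot> u = Zero A W Z"
  shows "\<exists>h \<in> Hom A W X. f \<cdot> h = u"
  using kernel_lift[of f g u W] assms unfolding ses_def by simp

end

context abelian_category
begin

lemmas biproduct_is_cokernel =
  preadditive_category.biproduct_is_kernel[OF preadditive_op, unfolded op_unfold]
lemmas is_cokernel_facts =
  preadditive_category.is_kernel_facts[OF preadditive_op, unfolded op_unfold]
lemmas ses_colift = preadditive_category.ses_lift[OF preadditive_op, unfolded op_unfold]
lemmas ses_epic = preadditive_category.ses_facts(3)[OF preadditive_op, unfolded op_unfold]

lemma biproduct_ses:
  assumes "biproduct_maps A X Y S i1 i2 p1 p2"
  shows "ses A i1 p2 X S Y"
  unfolding ses_def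
  using biproduct_maps_typing[OF assms] biproduct_is_kernel[OF assms]
    biproduct_is_cokernel[OF biproduct_maps_swap[OF assms]] by simp

text \<open>By normality \<open>f\<close> is the kernel of some \<open>g\<close>. Since
  \<open>g\<close> kills \<open>f\<close>, it factors through \<open>c\<close>; hence whatever
  \<open>c\<close> kills is killed by \<open>g\<close> and lifts to \<open>f\<close>.\<close>

lemma monic_kernel_of_cokernel:
  assumes "monic A f" and c: "is_cokernel A c f"
  shows "is_kernel A f c"
proof -
  obtain g where g: "is_kernel A f g" using monic_normal assms(1) by blast
  note tg = is_kernel_facts[OF g] and tc = is_cokernel_facts[OF c]
  have t: "f \<in> Mor A" "g \<in> Mor A" "c \<in> Mor A" "Cod A f = Dom A g" "Dom A c = Dom A g"
    "c \<cdot> f = Zero A (Dom A f) (Cod A c)" "Dom A f \<in> Ob A" "Dom A g \<in> Ob A" "Cod A c \<in> Ob A"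
    "Cod A g \<in> Ob A"
    using tg tc by simp_all
  have "g \<cdot> f = Zero A (Dom A f) (Cod A g)" using tg(3) .
  then obtain g' where g': "g' \<in> Hom A (Cod A c) (Cod A g)" "g' \<cdot> c = g"
    using cokernel_colift[OF c, of g "Cod A g"] tg(2) t(4) by metis
  show ?thesis
  proof (rule is_kernelI[of f "Dom A f" "Dom A g" c "Cod A c"])
    fix W u assume u: "u \<in> Hom A W (Dom A g)" "c \<cdot> u = Zero A W (Cod A c)"
    then have "g \<cdot> u = g' \<cdot> (c \<cdot> u)" using g' t assoc[of u c g'] by simp
    then have "g \<cdot> u = Zero A W (Cod A g)" using u g' t by simp
    then show "\<exists>h \<in> Hom A W (Dom A f). f \<cdot> h = u" using kernel_lift[OF g] u by blast
  qed (use t assms(1) in auto)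
qed

lemma sesI_cokernel:
  assumes "f \<in> Hom A X Y" "g \<in> Hom A Y Z" "monic A f" "is_cokernel A g f"
  shows "ses A f g X Y Z"
  using assms monic_kernel_of_cokernel unfolding ses_def by blast

lemma monic_ses:
  assumes "f \<in> Hom A X Y" "monic A f"
  shows "\<exists>g Z. ses A f g X Y Z"
proof -
  obtain c where c: "is_cokernel A c f" using cokernel_exists assms by auto
  then have "c \<in> Hom A Y (Cod A c)" using is_cokernel_facts[OF c] assms by simp
  then show ?thesis using sesI_cokernel[of f X Y c "Cod A c"] assms c by blast
qed

text \<open>That \<open>e\<close> is epic rests on normality. If \<open>u\<close> kills
  \<open>e\<close>, then \<open>e\<close> factors through the kernel \<open>k\<close> of
  \<open>u\<close>, so \<open>f\<close> factors through the monomorphism \<open>m \<cdot> k\<close>,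
  which is the kernel of some \<open>w\<close>. Then \<open>w\<close> kills \<open>f\<close>, hence
  factors through \<open>c\<close> and kills \<open>m\<close>. So \<open>m\<close> factors through
  \<open>m \<cdot> k\<close>, which gives \<open>k\<close> a right inverse and forces
  \<open>u\<close> to be zero.\<close>

lemma image_factorization:
  assumes m: "is_image A m f" and f: "f \<in> Hom A X Y"
  shows "\<exists>e. epic A e \<and> e \<in> Hom A X (Dom A m) \<and> m \<cdot> e = f"
proof -
  obtain c where c: "is_cokernel A c f" and mc: "is_kernel A m c"
    using m unfolding is_image_def by blast
  note tc = is_cokernel_facts[OF c] and tm = is_kernel_facts[OF mc]
  have t: "m \<in> Mor A" "c \<in> Mor A" "Cod A m = Y" "Dom A c = Y" "Dom A m \<in> Ob A" "Cod A c \<in> Ob A"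
    "c \<cdot> m = Zero A (Dom A m) (Cod A c)"
    using tc tm f by simp_all
  have "c \<cdot> f = Zero A X (Cod A c)" "f \<in> Hom A X (Dom A c)" using tc(3) f t by simp_all
  then obtain e where e: "e \<in> Hom A X (Dom A m)" "m \<cdot> e = f"
    using kernel_lift[OF mc] by blast
  have "epic A e"
  proof (rule epicI[OF e(1)])
    fix W u assume u: "u \<in> Hom A (Dom A m) W" "u \<cdot> e = Zero A X W"
    obtain k where k: "is_kernel A k u" using kernel_exists u by auto
    note tk = is_kernel_facts[OF k]
    have tk': "k \<in> Mor A" "Cod A k = Dom A m" "Dom A k \<in> Ob A" using tk u by simp_all
    obtain e' where e': "e' \<in> Hom A X (Dom A k)" "k \<cdot> e' = e"
      using kernel_lift[OF k, of e X] u e by auto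
    have "monic A (m \<cdot> k)"
    proof (rule monicI[of _ "Dom A k" Y])
      fix V w assume w: "w \<in> Hom A V (Dom A k)" "m \<cdot> k \<cdot> w = Zero A V Y"
      then have "m \<cdot> (k \<cdot> w) = Zero A V Y" using t tk' by (simp add: assoc)
      then have "k \<cdot> w = Zero A V (Dom A m)"
        using monic_Zero[OF kernel_monic[OF mc], of "k \<cdot> w" V Y "Dom A m"] w t tk' f by simp
      then show "w = Zero A V (Dom A k)"
        using monic_Zero[OF kernel_monic[OF k], of w V "Dom A m" "Dom A k"] w t tk' by simp
    qed (use t tk' f in auto)
    then obtain w where w: "is_kernel A (m \<cdot> k) w" using monic_normal by blast
    note tw = is_kernel_facts[OF w]
    have tw': "w \<in> Mor A" "Dom A w = Y" "Cod A w \<in> Ob A"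
      "w \<cdot> (m \<cdot> k) = Zero A (Dom A k) (Cod A w)"
      using tw t tk' by simp_all
    have "f = m \<cdot> k \<cdot> e'" using e e' t tk' by (simp add: assoc)
    then have "w \<cdot> f = Zero A X (Cod A w)"
      using assoc[of e' "m \<cdot> k" w] tw' t tk' e' by simp
    then obtain w' where w': "w' \<in> Hom A (Cod A c) (Cod A w)" "w' \<cdot> c = w"
      using cokernel_colift[OF c, of w "Cod A w"] tw' f by auto
    then have "w \<cdot> m = w' \<cdot> (c \<cdot> m)" using t assoc[of m c w'] by simp
    then have "w \<cdot> m = Zero A (Dom A m) (Cod A w)" using t w' by simp
    then obtain h where h: "h \<in> Hom A (Dom A m) (Dom A k)" "m \<cdot> k \<cdot> h = m"
      using kernel_lift[OF w, of m "Dom A m"] t tk' tw' f by auto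
    have "m \<cdot> (k \<cdot> h) = m \<cdot> Ident A (Dom A m)" using h t tk' by (simp add: assoc)
    then have kh: "k \<cdot> h = Ident A (Dom A m)"
      using monicD[OF kernel_monic[OF mc], of "k \<cdot> h" "Ident A (Dom A m)"] h t tk' by simp
    have "u = (u \<cdot> k) \<cdot> h" using kh u tk' h by (simp add: assoc)
    also have "\<dots> = Zero A (Dom A m) W" using tk u h tk' by simp
    finally show "u = Zero A (Dom A m) W" .
  qed
  then show ?thesis using e by blast
qed

text \<open>Exactness supplies one \<open>m\<close> that is both an image of \<open>f\<close> and a
  kernel of \<open>g\<close>. As \<open>f\<close> is monic, it is also a kernel of the cokernel
  \<open>c\<close> defining that image, so lifts through \<open>m\<close> become lifts through
  \<open>f\<close>. The cokernel half is the dual of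
  \<open>monic_kernel_of_cokernel\<close>.\<close>

lemma short_exact_ses:
  assumes "short_exact A f g" "f \<in> Hom A X Y" "g \<in> Hom A Y Z"
  shows "ses A f g X Y Z"
proof -
  obtain m c where m: "is_image A m f" "is_kernel A m g" "is_cokernel A c f" "is_kernel A m c"
    and "monic A f" "epic A g"
    using assms unfolding short_exact_def exact_def is_image_def by blast
  have f: "is_kernel A f c" using monic_kernel_of_cokernel m(3) \<open>monic A f\<close> by blast
  have t: "m \<in> Mor A" "Cod A m = Y" "Dom A m \<in> Ob A" "c \<in> Mor A" "Dom A c = Y" "Cod A c \<in> Ob A"
    "c \<cdot> m = Zero A (Dom A m) (Cod A c)" "g \<cdot> m = Zero A (Dom A m) Z"
    using is_kernel_facts[OF m(2)] is_kernel_facts[OF m(4)] assms by simp_all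
  obtain e where e: "e \<in> Hom A X (Dom A m)" "m \<cdot> e = f"
    using image_factorization m(1) assms(2) by blast
  have gf: "g \<cdot> f = Zero A X Z" using assoc[of e m g] e t assms by simp
  have "is_kernel A f g"
  proof (rule is_kernelI[OF assms(2,3) \<open>monic A f\<close> gf])
    fix W u assume u: "u \<in> Hom A W Y" "g \<cdot> u = Zero A W Z"
    then obtain h where h: "h \<in> Hom A W (Dom A m)" "m \<cdot> h = u"
      using kernel_lift[OF m(2), of u W] assms by auto
    have "c \<cdot> u = Zero A W (Cod A c)" using assoc[of h m c] h t by simp
    then show "\<exists>h \<in> Hom A W X. f \<cdot> h = u" using kernel_lift[OF f, of u W] u t assms by simp
  qed
  moreover have "is_cokernel A g f"
    using abelian_category.monic_kernel_of_cokernel[OF op_abelian, unfolded op_unfold]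
      \<open>epic A g\<close> \<open>is_kernel A f g\<close> by blast
  ultimately show ?thesis using assms unfolding ses_def by blast
qed

lemmas sesI_kernel = abelian_category.sesI_cokernel[OF op_abelian, unfolded op_unfold]
lemmas epic_ses = abelian_category.monic_ses[OF op_abelian, unfolded op_unfold]

lemma ses_exact:
  assumes "ses A f g X Y Z"
  shows "exact A f g" "monic A f" "epic A g" "is_image A f f"
proof -
  show "is_image A f f" unfolding is_image_def using ses_facts[OF assms] by blast
  then show "exact A f g" unfolding exact_def using ses_facts[OF assms] by auto
  show "monic A f" "epic A g" using ses_facts[OF assms] ses_epic[OF assms] by auto
qed

text \<open>\<open>P\<close> is built as the kernel of the difference of the two maps from the
  direct sum of \<open>X\<close> and \<open>Y\<close> to \<open>Z\<close>. The universal property is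
  part of the conclusion because later constructions map into pullbacks and, dually, out of
  pushouts.\<close>

lemma pullback_ses:
  assumes kg: "ses A k g K Y Z" and f: "f \<in> Hom A X Z"
  shows "\<exists>P k' g' f'. ses A k' g' K P X \<and> f' \<in> Hom A P Y \<and> f' \<cdot> k' = k \<and> g \<cdot> f' = f \<cdot> g' \<and>
    (\<forall>T. \<forall>u \<in> Hom A T X. \<forall>v \<in> Hom A T Y. f \<cdot> u = g \<cdot> v \<longrightarrow>
      (\<exists>w \<in> Hom A T P. g' \<cdot> w = u \<and> f' \<cdot> w = v)) \<and>
    (\<forall>T. \<forall>w \<in> Hom A T P. \<forall>w' \<in> Hom A T P. g' \<cdot> w = g' \<cdot> w' \<longrightarrow> f' \<cdot> w = f' \<cdot> w' \<longrightarrow> w = w')"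
proof -
  note kgf = ses_facts[OF kg]
  have ob: "X \<in> Ob A" "Y \<in> Ob A" "Z \<in> Ob A" "K \<in> Ob A" using kgf f by auto
  then obtain S i1 i2 p1 p2 where b: "biproduct_maps A X Y S i1 i2 p1 p2"
    using biproduct_exists[of X Y] unfolding biproduct_iff_maps by blast
  note t = biproduct_maps_typing[OF b] and s = biproduct_maps_simps[OF b]
  define \<phi> where "\<phi> = (f \<cdot> p1) \<boxplus> Neg A (g \<cdot> p2)"
  have \<phi>: "\<phi> \<in> Hom A S Z" using t f kgf unfolding \<phi>_def by simp
  have \<phi>_comp: "\<phi> \<cdot> w = (f \<cdot> (p1 \<cdot> w)) \<boxplus> Neg A (g \<cdot> (p2 \<cdot> w))" if "w \<in> Hom A T S" for w T
    using that t f kgf unfolding \<phi>_def by (simp add: distrib_right Neg_comp assoc)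
  have \<phi>i2: "\<phi> \<cdot> i2 = Neg A g"
    using \<phi>_comp[of i2 Y] t s f kgf ob by simp
  \<comment> \<open>On the summand \<open>Y\<close> the map \<open>\<phi>\<close> is the negative of
    \<open>g\<close>, which is epic.\<close>
  have g_Zero: "v = Zero A Z W" if v: "v \<in> Hom A Z W" and "v \<cdot> \<phi> \<cdot> i2 = Zero A Y W" for v W
  proof -
    have "v \<cdot> Neg A g = Zero A Y W" using that \<phi>i2 \<phi> t by (simp add: assoc)
    then have "v \<cdot> g = Zero A Y W"
      using Neg_eq_Zero[of "v \<cdot> g" Y W] v kgf by (simp add: comp_Neg)
    then show ?thesis using epic_Zero[OF ses_epic[OF kg]] v kgf by blast
  qed
  have "epic A \<phi>"
  proof (rule epicI[OF \<phi>])
    fix W v assume v: "v \<in> Hom A Z W" "v \<cdot> \<phi> = Zero A S W"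
    then show "v = Zero A Z W" using g_Zero[of v W] t ob by simp
  qed
  then obtain j P where j: "ses A j \<phi> P S Z" using epic_ses[OF \<phi>] by blast
  note jf = ses_facts[OF j]
  define g' f' where "g' = p1 \<cdot> j" and "f' = p2 \<cdot> j"
  have g': "g' \<in> Hom A P X" and f': "f' \<in> Hom A P Y" using jf t unfolding g'_def f'_def by simp_all
  have "(f \<cdot> g') \<boxplus> Neg A (g \<cdot> f') = Zero A P Z"
    using \<phi>_comp[OF jf(1)] jf unfolding g'_def f'_def by simp
  then have comm: "f \<cdot> g' = g \<cdot> f'"
    by (rule eq_if_diff_Zero) (use f g' f' kgf(2) in simp_all)
  have univ: "\<exists>w \<in> Hom A T P. g' \<cdot> w = u \<and> f' \<cdot> w = v"
    if u: "u \<in> Hom A T X" and v: "v \<in> Hom A T Y" and uv: "f \<cdot> u = g \<cdot> v" for T u v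
  proof -
    obtain w where w: "w \<in> Hom A T S" "p1 \<cdot> w = u" "p2 \<cdot> w = v"
      using biproduct_pair[OF b u v] by blast
    then have "\<phi> \<cdot> w = Zero A T Z" using \<phi>_comp[OF w(1)] uv v kgf by simp
    then obtain h where h: "h \<in> Hom A T P" "j \<cdot> h = w" using ses_lift[OF j w(1)] by blast
    have "g' \<cdot> h = u \<and> f' \<cdot> h = v"
      using assoc[of h j p1] assoc[of h j p2] w(2,3) h jf(1) t(3,4) unfolding g'_def f'_def by simp
    then show ?thesis using h(1) by blast
  qed
  have uniq: "w = w'" if w: "w \<in> Hom A T P" "w' \<in> Hom A T P" "g' \<cdot> w = g' \<cdot> w'" "f' \<cdot> w = f' \<cdot> w'"
    for T w w'
  proof -
    have "j \<cdot> w = j \<cdot> w'"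
      by (rule biproduct_pair_eqI[OF b, of _ T])
        (use w jf t in \<open>simp_all add: g'_def f'_def assoc\<close>)
    then show ?thesis using monicD[OF jf(3), of w w'] w jf by simp
  qed
  \<comment> \<open>If \<open>u\<close> kills \<open>g'\<close>, then \<open>u \<cdot> p1\<close>
    factors as \<open>v \<cdot> \<phi>\<close>. Restricting to \<open>Y\<close> shows that
    \<open>v\<close> is zero, and restricting to \<open>X\<close> then shows that \<open>u\<close>
    is zero.\<close>
  have "epic A g'"
  proof (rule epicI[OF g'])
    fix W u assume u: "u \<in> Hom A X W" "u \<cdot> g' = Zero A P W"
    then have "(u \<cdot> p1) \<cdot> j = Zero A P W" using jf t unfolding g'_def by (simp add: assoc)
    then obtain v where v: "v \<in> Hom A Z W" "v \<cdot> \<phi> = u \<cdot> p1"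
      using ses_colift[OF j, of "u \<cdot> p1" W] u t by auto
    have "v \<cdot> \<phi> \<cdot> i2 = Zero A Y W" using v(2) u t s ob by (simp add: assoc)
    then have "v = Zero A Z W" using g_Zero v by blast
    then have "u \<cdot> p1 = Zero A S W" using v \<phi> u by simp
    then have "u \<cdot> p1 \<cdot> i1 = Zero A X W" using t u by simp
    then show "u = Zero A X W" using t u s by (simp add: assoc)
  qed
  \<comment> \<open>The map with components zero and \<open>k\<close> embeds \<open>K\<close> as the
    kernel of \<open>g'\<close>.\<close>
  obtain k' where k': "k' \<in> Hom A K P" "g' \<cdot> k' = Zero A K X" "f' \<cdot> k' = k"
    using univ[of "Zero A K X" K k] kgf f ob by auto
  have "is_kernel A k' g'"
  proof (rule is_kernelI[OF k'(1) g' _ k'(2)])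
    show "monic A k'"
    proof (rule monicI[OF k'(1)])
      fix W u assume u: "u \<in> Hom A W K" "k' \<cdot> u = Zero A W P"
      then have "k \<cdot> u = Zero A W Y" using comp_cong_left[OF k'(3), of u] f' k' by simp
      then show "u = Zero A W K" using monic_Zero[OF kgf(3)] u kgf by blast
    qed
    fix W u assume u: "u \<in> Hom A W P" "g' \<cdot> u = Zero A W X"
    have "g \<cdot> (f' \<cdot> u) = f \<cdot> (g' \<cdot> u)"
      using comm assoc[of u f' g] assoc[of u g' f] u f' g' f kgf by simp
    then have "g \<cdot> (f' \<cdot> u) = Zero A W Z" using u f by simp
    then obtain h where h: "h \<in> Hom A W K" "k \<cdot> h = f' \<cdot> u"
      using ses_lift[OF kg, of "f' \<cdot> u" W] u f' by auto
    have "k' \<cdot> h = u"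
      by (rule uniq[of _ W])
        (use h u k' comp_cong_left[OF k'(2), of h] comp_cong_left[OF k'(3), of h] g' f' ob in simp_all)
    then show "\<exists>h \<in> Hom A W K. k' \<cdot> h = u" using h by blast
  qed
  then have "ses A k' g' K P X" using sesI_kernel k' g' \<open>epic A g'\<close> by blast
  moreover have "f' \<cdot> k' = k \<and> g \<cdot> f' = f \<cdot> g'" using k' comm by simp
  ultimately show ?thesis using f' univ uniq by blast
qed

lemmas pushout_ses = abelian_category.pullback_ses[OF op_abelian, unfolded op_unfold]

end

section \<open>Vanishing of extensions of degree one\<close>

text \<open>The working form of Ext^1(X,Y) = 0: \<open>Y\<close> is the kernel and \<open>X\<close>
  the quotient. For objects of \<open>A\<close> it is identified with the Yoneda version in
  \<open>Ext_vanishes_1_iff\<close>.\<close>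

definition split_ext :: "('o, 'm, 'z) precat_scheme \<Rightarrow> 'o \<Rightarrow> 'o \<Rightarrow> bool" where
  "split_ext A X Y \<longleftrightarrow>
    (\<forall>E f g. ses A f g Y E X \<longrightarrow> (\<exists>s \<in> Hom A X E. g \<cdot>\<^bsub>A\<^esub> s = Ident A X))"

context abelian_category
begin

text \<open>The endomorphism \<open>1 - s g\<close> is killed by \<open>g\<close>, so it factors
  through \<open>f\<close>; the factor is the missing projection \<open>r\<close>.\<close>

lemma section_biproduct:
  assumes fg: "ses A f g X Y Z" and s: "s \<in> Hom A Z Y" "g \<cdot> s = Ident A Z"
  shows "\<exists>r. biproduct_maps A X Z Y f s r g"
proof -
  note t = ses_facts[OF fg]
  define e where "e = Ident A Y \<boxplus> Neg A (s \<cdot> g)"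
  have e: "e \<in> Hom A Y Y" using t s unfolding e_def by simp
  have "g \<cdot> e = Zero A Y Z"
    using t s comp_cong_left[OF s(2), of g] unfolding e_def by (simp add: distrib_left comp_Neg)
  then obtain r where r: "r \<in> Hom A Y X" "f \<cdot> r = e" using ses_lift[OF fg e] by blast
  have "f \<cdot> (r \<cdot> f) = e \<cdot> f" using comp_cong_left[OF r(2), of f] r t by simp
  also have "\<dots> = f \<cdot> Ident A X"
    using t s unfolding e_def by (simp add: distrib_right Neg_comp assoc)
  finally have rf: "r \<cdot> f = Ident A X" using monicD[OF t(3), of "r \<cdot> f" "Ident A X"] r t by simp
  have "f \<cdot> (r \<cdot> s) = e \<cdot> s" using comp_cong_left[OF r(2), of s] r s t by simp
  also have "\<dots> = Zero A Z Y"
    using t s unfolding e_def by (simp add: distrib_right Neg_comp assoc)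
  finally have rs: "r \<cdot> s = Zero A Z X" using monic_Zero[OF t(3), of "r \<cdot> s"] r s t by simp
  have "(f \<cdot> r) \<boxplus> (s \<cdot> g) = Ident A Y \<boxplus> (Neg A (s \<cdot> g) \<boxplus> (s \<cdot> g))"
    unfolding r(2) e_def using t s by (subst Plus_assoc) simp_all
  then have "(f \<cdot> r) \<boxplus> (s \<cdot> g) = Ident A Y" using t s by simp
  then show ?thesis using t s r rf rs unfolding biproduct_maps_def by auto
qed

lemmas retraction_biproduct =
  abelian_category.section_biproduct[OF op_abelian, unfolded op_unfold]

lemma split_extI_retraction:
  assumes "\<And>E f g. ses A f g Y E X \<Longrightarrow> \<exists>r \<in> Hom A E Y. r \<cdot> f = Ident A Y"
  shows "split_ext A X Y"
  unfolding split_ext_def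
proof (intro allI impI)
  fix E f g assume fg: "ses A f g Y E X"
  then obtain r where "r \<in> Hom A E Y" "r \<cdot> f = Ident A Y" using assms by blast
  then obtain s where "biproduct_maps A X Y E s f g r" using retraction_biproduct[OF fg] by blast
  then show "\<exists>s \<in> Hom A X E. g \<cdot> s = Ident A X" unfolding biproduct_maps_def by blast
qed

lemma split_ext_retraction:
  assumes "split_ext A X Y" and fg: "ses A f g Y E X"
  shows "\<exists>r \<in> Hom A E Y. r \<cdot> f = Ident A Y"
proof -
  obtain s where "s \<in> Hom A X E" "g \<cdot> s = Ident A X" using assms unfolding split_ext_def by blast
  then obtain r where "biproduct_maps A Y X E f s r g" using section_biproduct[OF fg] by blast
  then show ?thesis unfolding biproduct_maps_def by blast
qed

text \<open>Duality turns sections into retractions, and either one splits the sequence. Hence the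
  notion is self-dual with its arguments exchanged.\<close>

lemma op_cat_split_ext: "split_ext (op_cat A) Y X \<longleftrightarrow> split_ext A X Y"
proof -
  have "split_ext (op_cat A) Y X \<longleftrightarrow>
    (\<forall>E f g. ses A f g Y E X \<longrightarrow> (\<exists>r \<in> Hom A E Y. r \<cdot> f = Ident A Y))"
    unfolding split_ext_def op_unfold by blast
  then show ?thesis using split_extI_retraction split_ext_retraction by blast
qed

lemmas op_unfold_split = op_unfold op_cat_split_ext

text \<open>Pulling the sequence back along \<open>u\<close> gives an extension of \<open>X\<close>
  by \<open>Y\<close>; a section of it, followed by the map to \<open>E\<close>, is the
  lift.\<close>

lemma split_ext_lift:
  assumes "split_ext A X Y" "ses A f g Y E Z" "u \<in> Hom A X Z"
  shows "\<exists>v \<in> Hom A X E. g \<cdot> v = u"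
proof -
  obtain P f' g' u' where P: "ses A f' g' Y P X" "u' \<in> Hom A P E" "g \<cdot> u' = u \<cdot> g'"
    using pullback_ses[OF assms(2,3)] by blast
  then obtain s where s: "s \<in> Hom A X P" "g' \<cdot> s = Ident A X"
    using assms(1) unfolding split_ext_def by blast
  note t = ses_facts[OF P(1)] ses_facts[OF assms(2)]
  have "g \<cdot> (u' \<cdot> s) = u"
    using comp_cong_left[OF P(3), of s] assoc[of s g' u] P s t assms(3) by simp
  then show ?thesis using P s t by (intro bexI[of _ "u' \<cdot> s"]) simp_all
qed

lemmas split_ext_extend =
  abelian_category.split_ext_lift[OF op_abelian, unfolded op_unfold_split]

text \<open>This is the piece Hom(X,Y) \<rightarrow> Hom(X,Z) \<rightarrow> Ext^1(X,K) \<rightarrow>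
  Ext^1(X,Y) of the long exact sequence, by hand. Extend \<open>k\<close> to \<open>h\<close> on
  \<open>E\<close>; then \<open>g \<cdot> h\<close> descends to \<open>w\<close> on
  \<open>X\<close>, and subtracting a lift of \<open>w\<close> from \<open>h\<close> makes it land
  in \<open>K\<close> without changing it on \<open>K\<close>.\<close>

lemma split_ext_kernel:
  assumes kg: "ses A k g K Y Z" and split: "split_ext A X Y"
    and surj: "\<And>u. u \<in> Hom A X Z \<Longrightarrow> \<exists>v \<in> Hom A X Y. g \<cdot> v = u"
  shows "split_ext A X K"
proof (rule split_extI_retraction)
  fix E a b assume ab: "ses A a b K E X"
  note t = ses_facts[OF kg] and t' = ses_facts[OF ab]
  obtain h where h: "h \<in> Hom A E Y" "h \<cdot> a = k" using split_ext_extend[OF split ab t(1)] by blast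
  have gh: "g \<cdot> h \<in> Hom A E Z" using h t(2) by simp
  have "g \<cdot> h \<cdot> a = Zero A K Z" using h t(1,2,4) t'(1) by (simp add: assoc)
  then obtain w where w: "w \<in> Hom A X Z" "w \<cdot> b = g \<cdot> h"
    using ses_colift[OF ab gh] by blast
  obtain v where v: "v \<in> Hom A X Y" "g \<cdot> v = w" using surj[OF w(1)] by blast
  have vb: "h \<boxplus> Neg A (v \<cdot> b) \<in> Hom A E Y" using h(1) v(1) t'(2) by simp
  have "g \<cdot> (v \<cdot> b) = g \<cdot> h" using comp_cong_left[OF v(2), of b] v(1) w(2) t(2) t'(2) by simp
  then have "g \<cdot> (h \<boxplus> Neg A (v \<cdot> b)) = Zero A E Z"
    using h(1) v(1) t(2) t'(2) by (simp add: distrib_left comp_Neg)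
  then obtain r where r: "r \<in> Hom A E K" "k \<cdot> r = h \<boxplus> Neg A (v \<cdot> b)"
    using ses_lift[OF kg vb] by blast
  have "k \<cdot> (r \<cdot> a) = (h \<boxplus> Neg A (v \<cdot> b)) \<cdot> a"
    using comp_cong_left[OF r(2), of a] r(1) t(1) t'(1) by simp
  also have "\<dots> = k \<cdot> Ident A K"
    using h v(1) t(1) t'(1,2,4) by (simp add: distrib_right Neg_comp assoc)
  finally have "r \<cdot> a = Ident A K" using monicD[OF t(3), of "r \<cdot> a" "Ident A K"] r t t' by simp
  then show "\<exists>r \<in> Hom A E K. r \<cdot> a = Ident A K" using r by blast
qed

lemmas split_ext_cokernel =
  abelian_category.split_ext_kernel[OF op_abelian, unfolded op_unfold_split]

text \<open>Extending \<open>i\<close> over \<open>E\<close> and composing with \<open>r\<close>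
  retracts \<open>E\<close> onto \<open>H\<close>.\<close>

lemma split_ext_summand:
  assumes "split_ext A X G" and i: "i \<in> Hom A H G" and r: "r \<in> Hom A G H" "r \<cdot> i = Ident A H"
  shows "split_ext A X H"
proof (rule split_extI_retraction)
  fix E a b assume ab: "ses A a b H E X"
  obtain h where h: "h \<in> Hom A E G" "h \<cdot> a = i" using split_ext_extend[OF assms(1) ab i] by blast
  have "(r \<cdot> h) \<cdot> a = Ident A H" using h r i ses_facts[OF ab] by (simp add: assoc)
  then show "\<exists>r \<in> Hom A E H. r \<cdot> a = Ident A H" using h r by (intro bexI[of _ "r \<cdot> h"]) simp_all
qed

text \<open>
  Given \<open>0 \<rightarrow> K \<rightarrow> E \<rightarrow> X \<rightarrow> 0\<close>, the map \<open>K \<rightarrow> K2\<close> extends to \<open>E \<rightarrow> K2\<close>. Together with \<open>E \<rightarrow> X\<close>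
  this gives an epimorphism from \<open>E\<close> onto the direct sum of \<open>K2\<close> and \<open>X\<close> with kernel \<open>K1\<close>, along
  which the inclusion of \<open>X\<close> lifts.
\<close>

lemma split_ext_extension:
  assumes ab: "ses A a b K1 K K2" and "split_ext A X K1" "split_ext A X K2"
  shows "split_ext A X K"
  unfolding split_ext_def
proof (intro allI impI)
  fix E k q assume kq: "ses A k q K E X"
  note t = ses_facts[OF ab] and t' = ses_facts[OF kq]
  obtain h where h: "h \<in> Hom A E K2" "h \<cdot> k = b"
    using split_ext_extend[OF assms(3) kq t(2)] by blast
  obtain S i1 i2 p1 p2 where S: "biproduct_maps A K2 X S i1 i2 p1 p2"
    using biproduct_exists[of K2 X] t t' unfolding biproduct_iff_maps by auto
  note s = biproduct_maps_typing[OF S] biproduct_maps_simps[OF S]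
  have E: "q \<in> Hom A E X" using t' by blast
  obtain \<phi> where \<phi>: "\<phi> \<in> Hom A E S" "p1 \<cdot> \<phi> = h" "p2 \<cdot> \<phi> = q"
    using biproduct_pair[OF S h(1) E] by blast
  have \<phi>k: "\<phi> \<cdot> k = i1 \<cdot> b"
  proof (rule biproduct_pair_eqI[OF S, of _ K])
    show "p1 \<cdot> (\<phi> \<cdot> k) = p1 \<cdot> (i1 \<cdot> b)"
      using comp_cong_left[OF \<phi>(2), of k] comp_cong_left[OF s(5), of b] \<phi> h s t t' by simp
    show "p2 \<cdot> (\<phi> \<cdot> k) = p2 \<cdot> (i1 \<cdot> b)"
      using comp_cong_left[OF \<phi>(3), of k] comp_cong_left[OF s(7), of b] \<phi> h s t t' by simp
  qed (use \<phi> s t t' in simp_all)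
  have "epic A \<phi>"
  proof (rule epicI[OF \<phi>(1)])
    fix W u assume u: "u \<in> Hom A S W" "u \<cdot> \<phi> = Zero A E W"
    have "u \<cdot> i1 \<cdot> b = Zero A K W"
      using assoc[of b i1 u] assoc[of k \<phi> u] \<phi>k u \<phi>(1) s t t' by simp
    then have ui1: "u \<cdot> i1 = Zero A K2 W"
      using epic_Zero[OF ses_epic[OF ab], of "u \<cdot> i1" K W K2] u s t by simp
    then have ui1': "u \<cdot> (i1 \<cdot> p1) = Zero A S W" using assoc[of p1 i1 u] u s by simp
    have "u = u \<cdot> ((i1 \<cdot> p1) \<boxplus> (i2 \<cdot> p2))" using s u by simp
    also have "\<dots> = (u \<cdot> (i1 \<cdot> p1)) \<boxplus> (u \<cdot> (i2 \<cdot> p2))" using u s(1-4) by (simp add: distrib_left)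
    also have "\<dots> = u \<cdot> i2 \<cdot> p2" using ui1' s(1-4) u by (simp add: assoc)
    finally have u2: "u = u \<cdot> i2 \<cdot> p2" .
    have "u \<cdot> \<phi> = u \<cdot> i2 \<cdot> (p2 \<cdot> \<phi>)"
      by (subst u2) (use assoc[of \<phi> p2 "u \<cdot> i2"] u \<phi>(1) s in simp)
    then have "u \<cdot> i2 \<cdot> q = Zero A E W" using u \<phi> by simp
    then have "u \<cdot> i2 = Zero A X W"
      using epic_Zero[OF ses_epic[OF kq], of "u \<cdot> i2" E W X] u s t' by simp
    then show "u = Zero A S W" using u2 u s by simp
  qed
  have ka: "k \<cdot> a \<in> Hom A K1 E" using t t' by simp
  have "is_kernel A (k \<cdot> a) \<phi>"
  proof (rule is_kernelI[OF ka \<phi>(1)])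
    show "monic A (k \<cdot> a)"
    proof (rule monicI[OF ka])
      fix W u assume u: "u \<in> Hom A W K1" "k \<cdot> a \<cdot> u = Zero A W E"
      then have "k \<cdot> (a \<cdot> u) = Zero A W E" using t t' by (simp add: assoc)
      then have "a \<cdot> u = Zero A W K" using monic_Zero[OF t'(3), of "a \<cdot> u" W E K] u t t' by simp
      then show "u = Zero A W K1" using monic_Zero[OF t(3), of u W K K1] u t by simp
    qed
    have "\<phi> \<cdot> (k \<cdot> a) = i1 \<cdot> (b \<cdot> a)"
      using comp_cong_left[OF \<phi>k, of a] assoc[of a b i1] \<phi> s t t' by simp
    then show "\<phi> \<cdot> (k \<cdot> a) = Zero A K1 S" using s t by simp
    fix W u assume u: "u \<in> Hom A W E" "\<phi> \<cdot> u = Zero A W S"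
    have "q \<cdot> u = Zero A W X" using comp_cong_left[OF \<phi>(3), of u] u \<phi> s by simp
    then obtain w where w: "w \<in> Hom A W K" "k \<cdot> w = u" using ses_lift[OF kq] u by blast
    have "h \<cdot> u = Zero A W K2" using comp_cong_left[OF \<phi>(2), of u] u \<phi> s by simp
    then have "b \<cdot> w = Zero A W K2" using assoc[of w k h] w h t' by simp
    then obtain z where z: "z \<in> Hom A W K1" "a \<cdot> z = w" using ses_lift[OF ab] w by blast
    have "k \<cdot> a \<cdot> z = u" using z w t t' by (simp add: assoc)
    then show "\<exists>h \<in> Hom A W K1. k \<cdot> a \<cdot> h = u" using z by blast
  qed
  then have "ses A (k \<cdot> a) \<phi> K1 E S" using sesI_kernel ka \<phi>(1) \<open>epic A \<phi>\<close> by blast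
  from split_ext_lift[OF assms(2) this s(2)]
  obtain v where v: "v \<in> Hom A X E" "\<phi> \<cdot> v = i2" by blast
  have "q \<cdot> v = Ident A X" using assoc[of v \<phi> p2] \<phi> v s by simp
  then show "\<exists>s \<in> Hom A X E. q \<cdot> s = Ident A X" using v by blast
qed

text \<open>A substitute for choosing preimages of elements: a map \<open>u\<close> into
  \<open>Z\<close> lifts through the epimorphism \<open>g\<close> after composing with an
  epimorphism onto its source.\<close>

lemma epic_cover:
  assumes "epic A g" "g \<in> Hom A Y Z" "u \<in> Hom A T Z"
  shows "\<exists>T' e v. epic A e \<and> e \<in> Hom A T' T \<and> v \<in> Hom A T' Y \<and> g \<cdot> v = u \<cdot> e"
proof -
  obtain k K where "ses A k g K Y Z" using epic_ses assms(1,2) by blast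
  from pullback_ses[OF this assms(3)] obtain P k' g' f' where
    "ses A k' g' K P T" "f' \<in> Hom A P Y" "g \<cdot> f' = u \<cdot> g'" by blast
  then show ?thesis using ses_epic ses_facts(2) by blast
qed

text \<open>The nine lemma, with the two outer columns and two rows given. It yields both that the
  middle column is short exact and that the kernels form a row; it serves the horseshoe argument and
  the final construction.\<close>

lemma three_by_three:
  assumes ip: "ses A i p C1 S C2" and fg: "ses A f g M1 M M2"
    and k1: "ses A a1 b1 N1 C1 M1" and k2: "ses A a2 b2 N2 C2 M2"
    and \<beta>: "\<beta> \<in> Hom A S M" and sq1: "\<beta> \<cdot> i = f \<cdot> b1" and sq2: "g \<cdot> \<beta> = b2 \<cdot> p"
  shows "\<exists>N a n1 n2. ses A a \<beta> N S M \<and> ses A n1 n2 N1 N N2"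
proof -
  note t = ses_facts[OF ip] ses_facts[OF fg] ses_facts[OF k1] ses_facts[OF k2]
  note ty = \<beta> ses_facts(1,2)[OF ip] ses_facts(1,2)[OF fg] ses_facts(1,2)[OF k1] ses_facts(1,2)[OF k2]
  have "epic A \<beta>"
  proof (rule epicI[OF \<beta>])
    fix W u assume u: "u \<in> Hom A M W" "u \<cdot> \<beta> = Zero A S W"
    have "u \<cdot> f \<cdot> b1 = Zero A C1 W" using assoc[of b1 f u] assoc[of i \<beta> u] sq1 u ty by simp
    then have "u \<cdot> f = Zero A M1 W"
      using epic_Zero[OF ses_epic[OF k1], of "u \<cdot> f"] u ty by simp
    then obtain v where v: "v \<in> Hom A M2 W" "v \<cdot> g = u" using ses_colift[OF fg] u by blast
    have "v \<cdot> b2 \<cdot> p = Zero A S W"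
      using assoc[of p b2 v] assoc[of \<beta> g v] sq2 u v ty by simp
    then have "v \<cdot> b2 = Zero A C2 W"
      using epic_Zero[OF ses_epic[OF ip], of "v \<cdot> b2"] v ty by simp
    then have "v = Zero A M2 W" using epic_Zero[OF ses_epic[OF k2]] v ty by blast
    then show "u = Zero A M W" using v ty by auto
  qed
  then obtain a N where a: "ses A a \<beta> N S M" using epic_ses \<beta> by blast
  note ta = ses_facts[OF a]
  have "\<beta> \<cdot> (i \<cdot> a1) = f \<cdot> (b1 \<cdot> a1)"
    using comp_cong_left[OF sq1, of a1] assoc[of a1 b1 f] ty by simp
  then have "\<beta> \<cdot> (i \<cdot> a1) = Zero A N1 M" using t ty by simp
  then obtain n1 where n1: "n1 \<in> Hom A N1 N" "a \<cdot> n1 = i \<cdot> a1"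
    using ses_lift[OF a, of "i \<cdot> a1" N1] ty by auto
  have "b2 \<cdot> (p \<cdot> a) = g \<cdot> (\<beta> \<cdot> a)"
    using assoc[of a p b2] assoc[of a \<beta> g] sq2 ta ty by simp
  then have "b2 \<cdot> (p \<cdot> a) = Zero A N M2" using ta ty by simp
  then obtain n2 where n2: "n2 \<in> Hom A N N2" "a2 \<cdot> n2 = p \<cdot> a"
    using ses_lift[OF k2, of "p \<cdot> a" N] ta ty by auto
  have "monic A n1"
  proof (rule monicI[OF n1(1)])
    fix W u assume u: "u \<in> Hom A W N1" "n1 \<cdot> u = Zero A W N"
    have "i \<cdot> (a1 \<cdot> u) = Zero A W S"
      using comp_cong_left[OF n1(2), of u] assoc[of u a1 i] u n1 ta ty by simp
    then have "a1 \<cdot> u = Zero A W C1"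
      using monic_Zero[of i "a1 \<cdot> u" W S C1] t(3) u ty by simp
    then show "u = Zero A W N1" using monic_Zero[OF ses_facts(3)[OF k1]] u ty by blast
  qed
  have "a2 \<cdot> (n2 \<cdot> n1) = (p \<cdot> i) \<cdot> a1"
    using comp_cong_left[OF n2(2), of n1] assoc[of n1 a p] assoc[of a1 i p] n1 n2 ta ty by simp
  then have "a2 \<cdot> (n2 \<cdot> n1) = Zero A N1 C2" using t(4) ty by simp
  then have n21: "n2 \<cdot> n1 = Zero A N1 N2"
    using monic_Zero[OF ses_facts(3)[OF k2], of "n2 \<cdot> n1" N1 C2 N2] n1 n2 ty by simp
  have "is_kernel A n1 n2"
  proof (rule is_kernelI[OF n1(1) n2(1) \<open>monic A n1\<close> n21])
    fix W u assume u: "u \<in> Hom A W N" "n2 \<cdot> u = Zero A W N2"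
    have "p \<cdot> (a \<cdot> u) = Zero A W C2"
      using comp_cong_left[OF n2(2), of u] assoc[of u a p] u n2 ta ty by simp
    then obtain w where w: "w \<in> Hom A W C1" "i \<cdot> w = a \<cdot> u"
      using ses_lift[OF ip, of "a \<cdot> u" W] u ta ty by auto
    have "\<beta> \<cdot> (a \<cdot> u) = Zero A W M" using assoc[of u a \<beta>] u ta ty by simp
    then have "f \<cdot> (b1 \<cdot> w) = Zero A W M"
      using comp_cong_left[OF sq1, of w] assoc[of w b1 f] w ty by simp
    then have "b1 \<cdot> w = Zero A W M1"
      using monic_Zero[OF ses_facts(3)[OF fg], of "b1 \<cdot> w" W M M1] w ty by simp
    then obtain z where z: "z \<in> Hom A W N1" "a1 \<cdot> z = w" using ses_lift[OF k1] w by blast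
    have "a \<cdot> (n1 \<cdot> z) = a \<cdot> u"
      using comp_cong_left[OF n1(2), of z] assoc[of z a1 i] z w n1 ta ty by simp
    then have "n1 \<cdot> z = u" using monicD[OF ta(3), of "n1 \<cdot> z" u] n1 z u ta by simp
    then show "\<exists>h \<in> Hom A W N1. n1 \<cdot> h = u" using z by blast
  qed
  have "epic A n2"
  \<comment> \<open>A diagram chase with covers in place of elements: lift \<open>a2\<close> through
    \<open>p\<close> to \<open>v\<close>, observe that \<open>\<beta> \<cdot> v\<close> comes from
    \<open>w\<close> into \<open>M1\<close>, and lift \<open>w\<close> through \<open>b1\<close> to
    \<open>y\<close>.\<close>
  proof (rule epicI[OF n2(1)])
    fix W u assume u: "u \<in> Hom A N2 W" "u \<cdot> n2 = Zero A N W"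
    obtain T e v where e: "epic A e" "e \<in> Hom A T N2" "v \<in> Hom A T S" "p \<cdot> v = a2 \<cdot> e"
      using epic_cover[OF ses_epic[OF ip], of S C2 a2 N2] ty by blast
    have "g \<cdot> (\<beta> \<cdot> v) = b2 \<cdot> (a2 \<cdot> e)"
      using comp_cong_left[OF sq2, of v] assoc[of v p b2] e ty by simp
    then have "g \<cdot> (\<beta> \<cdot> v) = Zero A T M2" using assoc[of e a2 b2] t e ty by simp
    then obtain w where w: "w \<in> Hom A T M1" "f \<cdot> w = \<beta> \<cdot> v"
      using ses_lift[OF fg, of "\<beta> \<cdot> v" T] e ty by auto
    obtain T' e' y where e': "epic A e'" "e' \<in> Hom A T' T" "y \<in> Hom A T' C1" "b1 \<cdot> y = w \<cdot> e'"
      using epic_cover[OF ses_epic[OF k1] _ w(1)] ty by blast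
    have eq: "\<beta> \<cdot> (i \<cdot> y) = \<beta> \<cdot> (v \<cdot> e')"
      using comp_cong_left[OF sq1, of y] comp_cong_left[OF w(2), of e'] assoc[of y b1 f]
        assoc[of e' v \<beta>] e e' w ty by simp
    \<comment> \<open>Subtracting \<open>i \<cdot> y\<close> puts the lift into the kernel of
      \<open>\<beta>\<close> and leaves its image under \<open>p\<close> unchanged, since
      \<open>p\<close> kills \<open>i\<close>.\<close>
    define d where "d = (v \<cdot> e') \<boxplus> Neg A (i \<cdot> y)"
    have d: "d \<in> Hom A T' S" using e e' ty unfolding d_def by simp
    have "\<beta> \<cdot> d = Zero A T' M"
      using eq e e' ty unfolding d_def by (simp add: distrib_left comp_Neg)
    then obtain x where x: "x \<in> Hom A T' N" "a \<cdot> x = d" using ses_lift[OF a d] by blast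
    have "p \<cdot> (i \<cdot> y) = Zero A T' C2" using assoc[of y i p] t(4) e' ty by simp
    then have pd: "p \<cdot> d = p \<cdot> (v \<cdot> e')"
      using e e' ty unfolding d_def by (simp add: distrib_left comp_Neg)
    have "a2 \<cdot> (n2 \<cdot> x) = p \<cdot> d"
      using comp_cong_left[OF n2(2), of x] assoc[of x a p] x n2 ta ty by simp
    also have "\<dots> = a2 \<cdot> (e \<cdot> e')"
      unfolding pd using comp_cong_left[OF e(4), of e'] assoc[of e' e a2] e e' ty by simp
    finally have nx: "n2 \<cdot> x = e \<cdot> e'"
      using monicD[OF ses_facts(3)[OF k2], of "n2 \<cdot> x" "e \<cdot> e'"] x n2 e e' ty by simp
    \<comment> \<open>The epimorphism \<open>e \<cdot> e'\<close> factors through \<open>n2\<close>,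
      so whatever kills \<open>n2\<close> kills it and vanishes.\<close>
    have "u \<cdot> e \<cdot> e' = u \<cdot> n2 \<cdot> x" using nx u(1) x(1) n2(1) e(2) e'(2) by (simp add: assoc)
    then have "u \<cdot> e \<cdot> e' = Zero A T' W" using u x n2 by simp
    then have "u \<cdot> e = Zero A T W" using epic_Zero[OF e'(1), of "u \<cdot> e" T' W T] u e e' by simp
    then show "u = Zero A N2 W" using epic_Zero[OF e(1)] u e by blast
  qed
  then have "ses A n1 n2 N1 N N2" using sesI_kernel n1 n2 \<open>is_kernel A n1 n2\<close> by blast
  then show ?thesis using a by blast
qed

text \<open>The kernel is the preimage of \<open>K2\<close> under \<open>p\<close>, that is, the
  pullback of \<open>p\<close> along \<open>k\<close>, which is an extension of \<open>K2\<close> by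
  \<open>K1\<close>.\<close>

lemma kernel_of_composite:
  assumes ap: "ses A a p K1 E F" and kq: "ses A k q K2 F G"
  shows "\<exists>K c u v. ses A c (q \<cdot> p) K E G \<and> ses A u v K1 K K2"
proof -
  note t = ses_facts[OF ap] and t' = ses_facts[OF kq]
  obtain K u v c where uv: "ses A u v K1 K K2" and c: "c \<in> Hom A K E" "p \<cdot> c = k \<cdot> v"
    and univ: "\<And>T x y. x \<in> Hom A T K2 \<Longrightarrow> y \<in> Hom A T E \<Longrightarrow> k \<cdot> x = p \<cdot> y \<Longrightarrow>
      \<exists>w \<in> Hom A T K. v \<cdot> w = x \<and> c \<cdot> w = y"
    and uniq: "\<And>T w w'. w \<in> Hom A T K \<Longrightarrow> w' \<in> Hom A T K \<Longrightarrow> v \<cdot> w = v \<cdot> w' \<Longrightarrow> c \<cdot> w = c \<cdot> w' \<Longrightarrow>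
      w = w'"
    using pullback_ses[OF ap t'(1)] by metis
  note tv = ses_facts[OF uv]
  have qp: "q \<cdot> p \<in> Hom A E G" using t t' by simp
  have "epic A (q \<cdot> p)"
  proof (rule epicI[OF qp])
    fix W x assume x: "x \<in> Hom A G W" "x \<cdot> (q \<cdot> p) = Zero A E W"
    then have "x \<cdot> q \<cdot> p = Zero A E W" using t t' by (simp add: assoc)
    then have "x \<cdot> q = Zero A F W" using epic_Zero[OF ses_epic[OF ap], of "x \<cdot> q" E W F] x t t' by simp
    then show "x = Zero A G W" using epic_Zero[OF ses_epic[OF kq]] x t' by blast
  qed
  moreover have "is_kernel A c (q \<cdot> p)"
  proof (rule is_kernelI[OF c(1) qp])
    show "monic A c"
    proof (rule monicI[OF c(1)])
      fix W w assume w: "w \<in> Hom A W K" "c \<cdot> w = Zero A W E"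
      have "k \<cdot> (v \<cdot> w) = p \<cdot> (c \<cdot> w)" using assoc[of w v k] assoc[of w c p] c w t t' tv by simp
      then have "k \<cdot> (v \<cdot> w) = Zero A W F" using w t by simp
      then have "v \<cdot> w = Zero A W K2" using monic_Zero[OF t'(3), of "v \<cdot> w" W F K2] w tv t' by simp
      then show "w = Zero A W K" using uniq[of w W "Zero A W K"] w c tv by simp
    qed
    have "q \<cdot> p \<cdot> c = (q \<cdot> k) \<cdot> v" using assoc[of c p q] assoc[of v k q] c t t' tv by simp
    then show "q \<cdot> p \<cdot> c = Zero A K G" using t' tv by simp
    fix W y assume y: "y \<in> Hom A W E" "q \<cdot> p \<cdot> y = Zero A W G"
    then have "q \<cdot> (p \<cdot> y) = Zero A W G" using t t' by (simp add: assoc)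
    then obtain x where "x \<in> Hom A W K2" "k \<cdot> x = p \<cdot> y"
      using ses_lift[OF kq, of "p \<cdot> y" W] y t by auto
    then show "\<exists>h \<in> Hom A W K. c \<cdot> h = y" using univ y by blast
  qed
  ultimately have "ses A c (q \<cdot> p) K E G" using sesI_kernel c qp by blast
  then show ?thesis using uv by blast
qed

section \<open>Comparison with Yoneda Ext in degree one\<close>

lemma extensions_1:
  "ds \<in> extensions A 1 X Y \<longleftrightarrow> (\<exists>E f g. ds = [f, g] \<and> ses A f g Y E X)"
proof
  assume ds: "ds \<in> extensions A 1 X Y"
  then have "length ds = 2" unfolding extensions_def by simp
  then obtain f g where fg: "ds = [f, g]"
    by (metis (no_types, lifting) One_nat_def Suc_1 length_0_conv length_Suc_conv)
  have *: "Dom A f = Y" "Cod A g = X" "monic A f" "epic A g" "exact A f g"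
    using ds unfolding extensions_def fg by auto
  then have "f \<in> Mor A" "g \<in> Mor A" "Cod A f = Dom A g" unfolding exact_def by auto
  then have "ses A f g Y (Dom A g) X"
    using * Dom_closed Cod_closed by (intro short_exact_ses) (auto simp: short_exact_def)
  then show "\<exists>E f g. ds = [f, g] \<and> ses A f g Y E X" using fg by blast
next
  assume "\<exists>E f g. ds = [f, g] \<and> ses A f g Y E X"
  then obtain E f g where "ds = [f, g]" "ses A f g Y E X" by blast
  then show "ds \<in> extensions A 1 X Y"
    using ses_exact[of f g Y E X] ses_facts(1,2)[of f g Y E X] unfolding extensions_def by simp
qed

lemma Yoneda_rel_1:
  assumes fg: "ses A f g Y E X" and fg': "ses A f' g' Y E' X"
  shows "([f, g], [f', g']) \<in> Yoneda_rel A 1 X Y \<longleftrightarrow>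
    (\<exists>h \<in> Hom A E E'. h \<cdot> f = f' \<and> g' \<cdot> h = g)"
proof -
  note t = ses_facts(1,2)[OF fg] ses_facts(1,2)[OF fg']
  have ext: "[f, g] \<in> extensions A 1 X Y" "[f', g'] \<in> extensions A 1 X Y"
    using extensions_1 fg fg' by blast+
  have mor: "extension_morphism A 1 X Y [f, g] [f', g'] h \<longleftrightarrow>
    h 0 = Ident A Y \<and> h 1 \<in> Hom A E E' \<and> h 2 = Ident A X \<and>
    h 1 \<cdot> f = f' \<cdot> h 0 \<and> h 2 \<cdot> g = g' \<cdot> h 1" for h
  proof -
    \<comment> \<open>For \<open>n = 1\<close> the bounded quantifiers unfold to three components
      and two squares.\<close>
    have *: "(\<forall>i \<le> Suc 0. P i) \<longleftrightarrow> P 0 \<and> P 1" "(\<forall>i \<le> Suc (Suc 0). P i) \<longleftrightarrow> P 0 \<and> P 1 \<and> P 2" for P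
      by (auto simp: le_Suc_eq numeral_2_eq_2)
    show ?thesis
      using t unfolding extension_morphism_def One_nat_def * extension_term_def
      by (simp add: numeral_2_eq_2) (metis Ident_typing)
  qed
  show ?thesis
  proof
    assume "([f, g], [f', g']) \<in> Yoneda_rel A 1 X Y"
    then obtain h where "extension_morphism A 1 X Y [f, g] [f', g'] h"
      unfolding Yoneda_rel_def by blast
    then have h: "h 0 = Ident A Y" "h 1 \<in> Hom A E E'" "h 2 = Ident A X" "h 1 \<cdot> f = f' \<cdot> h 0"
      "h 2 \<cdot> g = g' \<cdot> h 1"
      unfolding mor by blast+
    have "h 1 \<cdot> f = f'" using h(4) t(3) unfolding h(1) by simp
    moreover have "g' \<cdot> h 1 = g" using h(5) t(2) unfolding h(3) by simp
    ultimately show "\<exists>h \<in> Hom A E E'. h \<cdot> f = f' \<and> g' \<cdot> h = g" using h(2) by blast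
  next
    assume "\<exists>h \<in> Hom A E E'. h \<cdot> f = f' \<and> g' \<cdot> h = g"
    then obtain h where h: "h \<in> Hom A E E'" "h \<cdot> f = f'" "g' \<cdot> h = g" by blast
    define hs where "hs = (\<lambda>i :: nat. if i = 0 then Ident A Y else if i = 1 then h else Ident A X)"
    have "extension_morphism A 1 X Y [f, g] [f', g'] hs"
      unfolding mor using h t by (simp add: hs_def)
    then show "([f, g], [f', g']) \<in> Yoneda_rel A 1 X Y" using ext unfolding Yoneda_rel_def by blast
  qed
qed

text \<open>Having a section is invariant under the Yoneda relation, so if there is only the class
  of the biproduct, every extension splits. Conversely, a retraction \<open>r\<close> together with
  \<open>g\<close> maps a split extension to the biproduct.\<close>

lemma Ext_vanishes_1_iff:
  assumes ob: "X \<in> Ob A" "Y \<in> Ob A"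
  shows "Ext_vanishes A 1 X Y \<longleftrightarrow> split_ext A X Y"
proof
  define Sp where "Sp = {[f, g] |f g. \<exists>s \<in> Hom A X (Dom A g). g \<cdot> s = Ident A X}"
  obtain S i1 i2 p1 p2 where S: "biproduct_maps A Y X S i1 i2 p1 p2"
    using biproduct_exists[OF ob(2,1)] unfolding biproduct_iff_maps by blast
  note s = biproduct_ses[OF S] biproduct_maps_typing[OF S] biproduct_maps_simps[OF S]
  have s0: "[i1, p2] \<in> Sp" unfolding Sp_def using s by auto
  have e0: "[i1, p2] \<in> extensions A 1 X Y" using extensions_1 s by blast
  have rel: "ds \<in> Sp \<longleftrightarrow> es \<in> Sp" if r: "(ds, es) \<in> Yoneda_rel A 1 X Y" for ds es
  proof -
    have "ds \<in> extensions A 1 X Y" "es \<in> extensions A 1 X Y" using r unfolding Yoneda_rel_def by auto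
    then obtain E f g E' f' g' where d: "ds = [f, g]" "ses A f g Y E X"
      and e: "es = [f', g']" "ses A f' g' Y E' X"
      unfolding extensions_1 by blast
    note t = ses_facts(1,2)[OF d(2)] ses_facts(1,2)[OF e(2)]
    obtain h where h: "h \<in> Hom A E E'" "h \<cdot> f = f'" "g' \<cdot> h = g"
      using r Yoneda_rel_1[OF d(2) e(2)] unfolding d(1) e(1) by blast
    have "ds \<in> Sp \<longleftrightarrow> (\<exists>s \<in> Hom A X E. g \<cdot> s = Ident A X)"
      unfolding Sp_def d(1) using t(2) by simp
    moreover have "es \<in> Sp \<longleftrightarrow> (\<exists>s \<in> Hom A X E'. g' \<cdot> s = Ident A X)"
      unfolding Sp_def e(1) using t(4) by simp
    moreover have "\<exists>s \<in> Hom A X E'. g' \<cdot> s = Ident A X"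
      if "s \<in> Hom A X E" "g \<cdot> s = Ident A X" for s
      using that h t assoc[of s h g'] by (intro bexI[of _ "h \<cdot> s"]) simp_all
    \<comment> \<open>Sections do not pull back along \<open>h\<close> directly, but retractions do:
      a section of \<open>g'\<close> gives a retraction \<open>r\<close> of \<open>f'\<close>, and
      \<open>r \<cdot> h\<close> is one of \<open>f\<close>.\<close>
    moreover have "\<exists>s \<in> Hom A X E. g \<cdot> s = Ident A X"
      if s: "s \<in> Hom A X E'" "g' \<cdot> s = Ident A X" for s
    proof -
      obtain r where "biproduct_maps A Y X E' f' s r g'" using section_biproduct[OF e(2) s] by blast
      then have "r \<in> Hom A E' Y" "r \<cdot> f' = Ident A Y" unfolding biproduct_maps_def by auto
      then have "r \<cdot> h \<in> Hom A E Y" "r \<cdot> h \<cdot> f = Ident A Y" using h t by (simp_all add: assoc)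
      from retraction_biproduct[OF d(2) this]
      show ?thesis unfolding biproduct_maps_def by blast
    qed
    ultimately show ?thesis by blast
  qed
  note equiv = equiv_Yoneda_equiv[of A 1 X Y]
  show "split_ext A X Y" if van: "Ext_vanishes A 1 X Y"
    unfolding split_ext_def
  proof (intro allI impI)
    fix E f g assume fg: "ses A f g Y E X"
    then have e: "[f, g] \<in> extensions A 1 X Y" using extensions_1 by blast
    have "Yoneda_equiv A 1 X Y `` {[i1, p2]} = Yoneda_equiv A 1 X Y `` {[f, g]}"
      using van quotientI[OF e0, of "Yoneda_equiv A 1 X Y"] quotientI[OF e, of "Yoneda_equiv A 1 X Y"]
      unfolding Ext_vanishes_def Ext_def is_singleton_def by (metis singletonD)
    then have "([i1, p2], [f, g]) \<in> Yoneda_equiv A 1 X Y" using eq_equiv_class[OF _ equiv e] by blast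
    then have "([i1, p2], [f, g]) \<in> (Yoneda_rel A 1 X Y \<union> (Yoneda_rel A 1 X Y)\<inverse>)\<^sup>*"
      unfolding Yoneda_equiv_def by blast
    then have "[f, g] \<in> Sp"
      using s0 by (induction rule: rtrancl_induct) (use rel in blast)+
    then show "\<exists>s \<in> Hom A X E. g \<cdot> s = Ident A X"
      using ses_facts(2)[OF fg] unfolding Sp_def by simp
  qed
  show "Ext_vanishes A 1 X Y" if split: "split_ext A X Y"
  proof -
    have "(ds, [i1, p2]) \<in> Yoneda_equiv A 1 X Y" if ds: "ds \<in> extensions A 1 X Y" for ds
    proof -
      obtain E f g where d: "ds = [f, g]" "ses A f g Y E X" using ds extensions_1 by blast
      note t = ses_facts[OF d(2)]
      obtain r where r: "r \<in> Hom A E Y" "r \<cdot> f = Ident A Y"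
        using split_ext_retraction[OF split d(2)] by blast
      obtain h where h: "h \<in> Hom A E S" "p1 \<cdot> h = r" "p2 \<cdot> h = g"
        using biproduct_pair[OF S r(1) t(2)] by blast
      have "h \<cdot> f = i1"
        by (rule biproduct_pair_eqI[OF S, of _ Y])
          (use h r t s assoc[of f h p1] assoc[of f h p2] in simp_all)
      then have "(ds, [i1, p2]) \<in> Yoneda_rel A 1 X Y"
        unfolding d(1) Yoneda_rel_1[OF d(2) s(1)] using h by blast
      then show ?thesis using ds e0 unfolding Yoneda_equiv_def by blast
    qed
    then have "Ext A 1 X Y = {Yoneda_equiv A 1 X Y `` {[i1, p2]}}"
      unfolding Ext_def quotient_def using e0 equiv_class_eq[OF equiv] by auto
    then show ?thesis unfolding Ext_vanishes_def by simp
  qed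
qed

end

section \<open>Gorenstein objects\<close>

text \<open>A complete resolution cut into short exact sequences. \<open>Z n\<close> is the image of
  the differential leaving \<open>K n\<close>, so \<open>Z (n + 1)\<close> is the kernel at
  \<open>K n\<close>, and \<open>Z 0\<close> is the object being resolved.\<close>

definition spliced ::
  "('o, 'm, 'z) precat_scheme \<Rightarrow> 'o set \<Rightarrow> (int \<Rightarrow> 'o) \<Rightarrow> (int \<Rightarrow> 'o) \<Rightarrow> (int \<Rightarrow> 'm) \<Rightarrow> (int \<Rightarrow> 'm) \<Rightarrow> bool"
  where "spliced A \<C> K Z f g \<longleftrightarrow>
    (\<forall>n. K n \<in> \<C> \<and> ses A (f n) (g n) (Z (n + 1)) (K n) (Z n) \<and>
      (\<forall>X \<in> \<C>. split_ext A X (Z n) \<and> split_ext A (Z n) X))"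

definition complete_resolution ::
  "('o, 'm, 'z) precat_scheme \<Rightarrow> 'o set \<Rightarrow> (int \<Rightarrow> 'o) \<Rightarrow> (int \<Rightarrow> 'm) \<Rightarrow> bool"
  where "complete_resolution A \<C> K d \<longleftrightarrow>
    (\<forall>n. K n \<in> \<C> \<and> d n \<in> Hom A (K n) (K (n - 1)) \<and> exact A (d (n + 1)) (d n) \<and>
      Hom_from_exact A \<C> (d (n + 1)) (d n) \<and> Hom_to_exact A \<C> (d (n + 1)) (d n))"

lemma Gorenstein_iff:
  "M \<in> Gorenstein A \<C> \<longleftrightarrow> M \<in> Ob A \<and> (\<exists>K d m. complete_resolution A \<C> K d \<and>
    is_image A m (d 0) \<and> isomorphic A M (Dom A m))"
  unfolding Gorenstein_def complete_resolution_def mem_Collect_eq ex_simps by (rule refl)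

text \<open>The condition is coinductive: the kernel \<open>N\<close> must lie in
  \<open>\<S>\<close> again, so the step can be iterated. The coresolution half is the same notion
  at \<open>op_cat A\<close>, which halves the closure proofs.\<close>

definition left_resolved :: "('o, 'm, 'z) precat_scheme \<Rightarrow> 'o set \<Rightarrow> 'o set \<Rightarrow> bool" where
  "left_resolved A \<C> \<S> \<longleftrightarrow> (\<forall>M \<in> \<S>. M \<in> Ob A \<and> (\<forall>X \<in> \<C>. split_ext A X M) \<and>
    (\<exists>X \<in> \<C>. \<exists>N \<in> \<S>. \<exists>f g. ses A f g N X M))"

definition totally_resolved :: "('o, 'm, 'z) precat_scheme \<Rightarrow> 'o set \<Rightarrow> 'o set \<Rightarrow> bool" where
  "totally_resolved A \<C> \<S> \<longleftrightarrow> left_resolved A \<C> \<S> \<and> left_resolved (op_cat A) \<C> \<S>"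

lemma op_cat_Hom_from_exact [simp]:
  "Hom_from_exact (op_cat A) \<C> g f \<longleftrightarrow> Hom_to_exact A \<C> f g"
  by (simp add: Hom_from_exact_def Hom_to_exact_def)

context abelian_category
begin

text \<open>The relation \<open>g \<cdot> f = 0\<close> puts the image inside the kernel, which
  reduces exactness to a lifting property.\<close>

lemma Hom_from_exact_iff:
  assumes f: "f \<in> Hom A W K" and g: "g \<in> Hom A K V" and gf: "g \<cdot> f = Zero A W V"
  shows "Hom_from_exact A \<C> f g \<longleftrightarrow>
    (\<forall>X \<in> \<C>. \<forall>v \<in> Hom A X K. g \<cdot> v = Zero A X V \<longrightarrow> (\<exists>u \<in> Hom A X W. f \<cdot> u = v))"
proof -
  have ty: "Dom A f = W" "Dom A g = K" "Cod A g = V" using f g by auto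
  have "(\<lambda>u. f \<cdot> u) ` Hom A X W \<subseteq> {v \<in> Hom A X K. g \<cdot> v = Zero A X V}" for X
  proof
    fix v assume "v \<in> (\<lambda>u. f \<cdot> u) ` Hom A X W"
    then obtain u where u: "u \<in> Hom A X W" "v = f \<cdot> u" by blast
    have "g \<cdot> v = Zero A X V" using comp_cong_left[OF gf, of u] u f g by simp
    then show "v \<in> {v \<in> Hom A X K. g \<cdot> v = Zero A X V}" using u f by simp
  qed
  then have "(\<lambda>u. f \<cdot> u) ` Hom A X W = {v \<in> Hom A X K. g \<cdot> v = Zero A X V} \<longleftrightarrow>
    {v \<in> Hom A X K. g \<cdot> v = Zero A X V} \<subseteq> (\<lambda>u. f \<cdot> u) ` Hom A X W" for X
    by blast
  also have "({v \<in> Hom A X K. g \<cdot> v = Zero A X V} \<subseteq> (\<lambda>u. f \<cdot> u) ` Hom A X W) \<longleftrightarrow>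
    (\<forall>v \<in> Hom A X K. g \<cdot> v = Zero A X V \<longrightarrow> (\<exists>u \<in> Hom A X W. f \<cdot> u = v))" for X
  proof (intro iffI ballI impI subsetI)
    fix v assume sub: "{v \<in> Hom A X K. g \<cdot> v = Zero A X V} \<subseteq> (\<lambda>u. f \<cdot> u) ` Hom A X W"
      and v: "v \<in> Hom A X K" "g \<cdot> v = Zero A X V"
    have "v \<in> (\<lambda>u. f \<cdot> u) ` Hom A X W" by (rule subsetD[OF sub]) (use v in blast)
    then show "\<exists>u \<in> Hom A X W. f \<cdot> u = v" by blast
  next
    fix v assume "\<forall>v \<in> Hom A X K. g \<cdot> v = Zero A X V \<longrightarrow> (\<exists>u \<in> Hom A X W. f \<cdot> u = v)"
      and "v \<in> {v \<in> Hom A X K. g \<cdot> v = Zero A X V}"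
    then show "v \<in> (\<lambda>u. f \<cdot> u) ` Hom A X W" by blast
  qed
  finally have "(\<lambda>u. f \<cdot> u) ` Hom A X W = {v \<in> Hom A X K. g \<cdot> v = Zero A X V} \<longleftrightarrow>
    (\<forall>v \<in> Hom A X K. g \<cdot> v = Zero A X V \<longrightarrow> (\<exists>u \<in> Hom A X W. f \<cdot> u = v))" for X .
  then show ?thesis unfolding Hom_from_exact_def kernel_def Hom_group_simps ty by simp
qed

text \<open>Precomposition with an epimorphism does not change which maps vanish after
  \<open>f\<close>.\<close>

lemma cokernel_comp_epic:
  assumes c: "is_cokernel A c f" and e: "epic A e" "e \<in> Hom A W (Dom A f)"
  shows "is_cokernel A c (f \<cdot> e)"
proof -
  note t = is_cokernel_facts[OF c]
  have fe: "f \<cdot> e \<in> Hom A W (Cod A f)" using t e by simp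
  show ?thesis
  proof (rule is_cokernelI[where K = "Cod A c" and X = "Cod A f" and Y = W])
    show "epic A c" using cokernel_epic c .
    show "c \<cdot> (f \<cdot> e) = Zero A W (Cod A c)" using comp_cong_left[OF t(3), of e] t(1,2) e(2) by simp
    show "c \<in> Hom A (Cod A f) (Cod A c)" using t(1) .
    show "f \<cdot> e \<in> Hom A W (Cod A f)" using fe .
    fix V u assume u: "u \<in> Hom A (Cod A f) V" "u \<cdot> (f \<cdot> e) = Zero A W V"
    then have "u \<cdot> f \<cdot> e = Zero A W V" using t e by (simp add: assoc)
    then have "u \<cdot> f = Zero A (Dom A f) V"
      using epic_Zero[OF e(1), of "u \<cdot> f" W V "Dom A f"] u(1) e(2) t(2) by simp
    then show "\<exists>h \<in> Hom A (Cod A c) V. h \<cdot> c = u" using cokernel_colift[OF c] u(1) by blast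
  qed
qed

lemmas kernel_comp_monic =
  abelian_category.cokernel_comp_epic[OF op_abelian, unfolded op_unfold]

lemma kernel_of_monic_comp:
  assumes k: "is_kernel A k (m \<cdot> e)" and m: "monic A m" "m \<in> Hom A Y Z" and e: "e \<in> Hom A X Y"
  shows "is_kernel A k e"
proof (rule is_kernelI[of k "Dom A k" X e Y])
  note t = is_kernel_facts[OF k]
  have me: "m \<cdot> e \<in> Hom A X Z" using m e by simp
  show kH: "k \<in> Hom A (Dom A k) X" using t(1) me by simp
  show "e \<in> Hom A X Y" by fact
  show "monic A k" using kernel_monic k .
  have "m \<cdot> (e \<cdot> k) = Zero A (Dom A k) Z" using t(3) kH m e by (simp add: assoc)
  then show "e \<cdot> k = Zero A (Dom A k) Y"
    using monic_Zero[OF m(1), of "e \<cdot> k" "Dom A k" Z Y] kH m e by simp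
  fix W u assume u: "u \<in> Hom A W X" "e \<cdot> u = Zero A W Y"
  have "m \<cdot> e \<cdot> u = Zero A W Z" using assoc[of u e m] u e m by simp
  then show "\<exists>h \<in> Hom A W (Dom A k). k \<cdot> h = u" using kernel_lift[OF k, of u W] u me by simp
qed

text \<open>\<open>exact\<close> provides some image that is a kernel of \<open>g\<close>; this
  transfers the property to another chosen image. Each image is reached from \<open>X\<close> by an
  epimorphism, so \<open>g\<close> kills \<open>m\<close> and \<open>c\<close> kills
  \<open>m'\<close>.\<close>

lemma image_kernel_unique:
  assumes m: "is_image A m f" and m': "is_image A m' f" and k: "is_kernel A m' g"
    and f: "f \<in> Hom A X Y" and g: "g \<in> Hom A Y Z"
  shows "is_kernel A m g"
proof -
  obtain c where c: "is_cokernel A c f" "is_kernel A m c" using m unfolding is_image_def by blast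
  obtain e where e: "epic A e" "e \<in> Hom A X (Dom A m)" "m \<cdot> e = f"
    using image_factorization[OF m f] by blast
  obtain e' where e': "epic A e'" "e' \<in> Hom A X (Dom A m')" "m' \<cdot> e' = f"
    using image_factorization[OF m' f] by blast
  note t = is_cokernel_facts[OF c(1)] is_kernel_facts[OF c(2)] is_kernel_facts[OF k]
  have mH: "m \<in> Hom A (Dom A m) Y" and cH: "c \<in> Hom A Y (Cod A c)" and mH': "m' \<in> Hom A (Dom A m') Y"
    using t f g by simp_all
  have gf: "g \<cdot> f = Zero A X Z" using assoc[of e' m' g] e' mH' g t(9) by simp
  have "c \<cdot> m' \<cdot> e' = Zero A X (Cod A c)" using assoc[of e' m' c] e' mH' cH t(3) f by simp
  then have cm': "c \<cdot> m' = Zero A (Dom A m') (Cod A c)"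
    using epic_Zero[OF e'(1), of "c \<cdot> m'" X "Cod A c" "Dom A m'"] e' mH' cH by simp
  show ?thesis
  proof (rule is_kernelI[OF mH g])
    show "monic A m" using kernel_monic c(2) .
    have "g \<cdot> m \<cdot> e = Zero A X Z" using assoc[of e m g] e mH g gf by simp
    then show "g \<cdot> m = Zero A (Dom A m) Z"
      using epic_Zero[OF e(1), of "g \<cdot> m" X Z "Dom A m"] e mH g by simp
    fix W u assume u: "u \<in> Hom A W Y" "g \<cdot> u = Zero A W Z"
    then obtain h where h: "h \<in> Hom A W (Dom A m')" "m' \<cdot> h = u"
      using kernel_lift[OF k, of u W] g by auto
    have "c \<cdot> u = Zero A W (Cod A c)" using assoc[of h m' c] h mH' cH cm' by simp
    then show "\<exists>h \<in> Hom A W (Dom A m). m \<cdot> h = u" using kernel_lift[OF c(2), of u W] u cH by simp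
  qed
qed

text \<open>Images are determined only up to isomorphism, so composing with the given isomorphism
  makes \<open>M\<close> itself the source.\<close>

lemma image_isomorphic:
  assumes m: "is_image A m f" and M: "isomorphic A M (Dom A m)"
  shows "\<exists>m'. is_image A m' f \<and> Dom A m' = M"
proof -
  obtain c where c: "is_cokernel A c f" "is_kernel A m c" using m unfolding is_image_def by blast
  obtain \<phi> \<psi> where \<phi>: "\<phi> \<in> Hom A M (Dom A m)" and \<psi>: "\<psi> \<in> Hom A (Dom A m) M"
    and inv: "\<psi> \<cdot> \<phi> = Ident A M" "\<phi> \<cdot> \<psi> = Ident A (Dom A m)"
    using M unfolding isomorphic_def by blast
  note t = is_kernel_facts[OF c(2)]
  have m\<phi>: "m \<cdot> \<phi> \<in> Hom A M (Dom A c)" using t(1) \<phi> by simp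
  have "is_kernel A (m \<cdot> \<phi>) c"
  proof (rule is_kernelI[OF m\<phi> t(2)])
    show "monic A (m \<cdot> \<phi>)"
    proof (rule monicI[OF m\<phi>])
      fix W u assume u: "u \<in> Hom A W M" "m \<cdot> \<phi> \<cdot> u = Zero A W (Dom A c)"
      then have "m \<cdot> (\<phi> \<cdot> u) = Zero A W (Dom A c)" using t(1) \<phi> by (simp add: assoc)
      then have "\<phi> \<cdot> u = Zero A W (Dom A m)"
        using monic_Zero[OF kernel_monic[OF c(2)], of "\<phi> \<cdot> u" W "Dom A c" "Dom A m"] u \<phi> t(1) by simp
      then show "u = Zero A W M" using comp_cong_left[OF inv(1), of u] u \<phi> \<psi> by simp
    qed
    show "c \<cdot> (m \<cdot> \<phi>) = Zero A M (Cod A c)" using comp_cong_left[OF t(3), of \<phi>] t(1,2) \<phi> by simp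
    fix W u assume u: "u \<in> Hom A W (Dom A c)" "c \<cdot> u = Zero A W (Cod A c)"
    then obtain h where h: "h \<in> Hom A W (Dom A m)" "m \<cdot> h = u" using kernel_lift[OF c(2)] by blast
    have "m \<cdot> \<phi> \<cdot> (\<psi> \<cdot> h) = m \<cdot> (\<phi> \<cdot> \<psi> \<cdot> h)" using t(1) \<phi> \<psi> h(1) by (simp add: assoc)
    then have "m \<cdot> \<phi> \<cdot> (\<psi> \<cdot> h) = u" using inv(2) h by simp
    then show "\<exists>h \<in> Hom A W M. m \<cdot> \<phi> \<cdot> h = u" using \<psi> h(1) by (intro bexI[of _ "\<psi> \<cdot> h"]) simp_all
  qed
  then show ?thesis using c(1) m\<phi> unfolding is_image_def by auto
qed

text \<open>A map killed by \<open>m \<cdot> g\<close> factors through \<open>Z1\<close>, and it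
  lifts further to \<open>K1\<close> because Ext^1(X,Z2) vanishes. In the application
  \<open>m\<close> is the inclusion of \<open>Z0\<close> into the next term.\<close>

lemma Hom_from_exact_splice:
  assumes fg': "ses A f' g' Z2 K1 Z1" and fg: "ses A f g Z1 K0 Z0"
    and m: "m \<in> Hom A Z0 V" "monic A m" and split: "\<forall>X \<in> \<C>. split_ext A X Z2"
  shows "Hom_from_exact A \<C> (f \<cdot> g') (m \<cdot> g)"
proof -
  note t = ses_facts[OF fg] ses_facts[OF fg']
  have d: "f \<cdot> g' \<in> Hom A K1 K0" "m \<cdot> g \<in> Hom A K0 V" using t m by simp_all
  have "m \<cdot> g \<cdot> (f \<cdot> g') = m \<cdot> ((g \<cdot> f) \<cdot> g')" using t(1,2,7,8) m by (simp add: assoc)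
  then have dd: "m \<cdot> g \<cdot> (f \<cdot> g') = Zero A K1 V" using t(4,7,8) m(1) by simp
  show ?thesis unfolding Hom_from_exact_iff[OF d dd]
  proof (intro ballI impI)
    fix X v assume X: "X \<in> \<C>" and v: "v \<in> Hom A X K0" "m \<cdot> g \<cdot> v = Zero A X V"
    then have "m \<cdot> (g \<cdot> v) = Zero A X V" using m t(2) by (simp add: assoc)
    then have "g \<cdot> v = Zero A X Z0" using monic_Zero[OF m(2), of "g \<cdot> v" X V Z0] v m t(2) by simp
    then obtain w where w: "w \<in> Hom A X Z1" "f \<cdot> w = v" using ses_lift[OF fg v(1)] by blast
    obtain u where u: "u \<in> Hom A X K1" "g' \<cdot> u = w"
      using split_ext_lift[OF _ fg' w(1)] split X by blast
    have "f \<cdot> g' \<cdot> u = v" using u w t(1) t(8) by (simp add: assoc)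
    then show "\<exists>u \<in> Hom A X K1. f \<cdot> g' \<cdot> u = v" using u by blast
  qed
qed

lemmas op_unfold_exact = op_unfold_split op_cat_Hom_from_exact

lemmas Hom_to_exact_iff = abelian_category.Hom_from_exact_iff[OF op_abelian, unfolded op_unfold_exact]
lemmas Hom_to_exact_splice =
  abelian_category.Hom_from_exact_splice[OF op_abelian, unfolded op_unfold_exact]

lemma spliced_imp_Gorenstein:
  assumes sp: "spliced A \<C> K Z f g"
  shows "Z 0 \<in> Gorenstein A \<C>"
proof -
  have K: "K n \<in> \<C>" and s: "ses A (f n) (g n) (Z (n + 1)) (K n) (Z n)"
    and split: "\<forall>X \<in> \<C>. split_ext A X (Z n)" "\<forall>X \<in> \<C>. split_ext A (Z n) X" for n
    using sp unfolding spliced_def by auto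
  \<comment> \<open>The differential passes through \<open>Z n\<close>, which embeds in
    \<open>K (n - 1)\<close>.\<close>
  define d where "d n = f (n - 1) \<cdot> g n" for n
  have s': "ses A (f (n - 1)) (g (n - 1)) (Z n) (K (n - 1)) (Z (n - 1))" for n
    using s[of "n - 1"] by simp
  have s'': "ses A (f (n + 1)) (g (n + 1)) (Z (n + 2)) (K (n + 1)) (Z (n + 1))" for n
    using s[of "n + 1"] by (simp add: add.assoc)
  have gE: "epic A (g n)" and fM: "monic A (f n)" for n
    using ses_epic[OF s] ses_facts(3)[OF s] by auto
  have dH: "d n \<in> Hom A (K n) (K (n - 1))" for n
    using ses_facts(1)[OF s'[of n]] ses_facts(2)[OF s[of n]] unfolding d_def by simp
  \<comment> \<open>Composing \<open>f n\<close> with the epimorphism \<open>g (n + 1)\<close> keeps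
    the cokernel \<open>g n\<close>, whose kernel is \<open>f n\<close>.\<close>
  have im: "is_image A (f n) (d (n + 1))" for n
  proof -
    have "is_cokernel A (g n) (f n \<cdot> g (n + 1))"
      using cokernel_comp_epic[OF ses_facts(6)[OF s[of n]] gE, of "n + 1" "K (n + 1)"]
        ses_facts(2)[OF s''[of n]] ses_facts(1)[OF s[of n]] by simp
    then show ?thesis using ses_facts(5)[OF s[of n]] unfolding is_image_def d_def by auto
  qed
  have ker: "is_kernel A (f n) (d n)" for n
    using kernel_comp_monic[OF ses_facts(5)[OF s[of n]] fM, of "n - 1" "K (n - 1)"]
      ses_facts(1)[OF s'[of n]] ses_facts(2)[OF s[of n]] unfolding d_def by simp
  have "exact A (d (n + 1)) (d n)" for n
    unfolding exact_def using im ker dH[of n] dH[of "n + 1"] by auto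
  moreover have "Hom_from_exact A \<C> (d (n + 1)) (d n)" for n
    using Hom_from_exact_splice[OF s''[of n] s[of n] ses_facts(1)[OF s'[of n]] fM split(1)]
    unfolding d_def by simp
  moreover have "Hom_to_exact A \<C> (d (n + 1)) (d n)" for n
    using Hom_to_exact_splice[OF s'[of n] s[of n] ses_facts(2)[OF s''[of n]] gE split(2)]
    unfolding d_def by simp
  moreover have "is_image A (f (- 1)) (d 0)" "Dom A (f (- 1)) = Z 0" "Z 0 \<in> Ob A"
    using im[of "- 1"] ses_facts(1)[OF s'[of 0]] by simp_all
  moreover have "isomorphic A (Z 0) (Z 0)"
    using \<open>Z 0 \<in> Ob A\<close> unfolding isomorphic_def
    by (intro conjI bexI[of _ "Ident A (Z 0)"]) simp_all
  moreover have "complete_resolution A \<C> K d"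
    unfolding complete_resolution_def using K dH calculation(1-3) by blast
  ultimately show ?thesis unfolding Gorenstein_iff by metis
qed

text \<open>Every differential is factored through its image; the two kinds of Hom-exactness then
  become the two kinds of orthogonality of the images, by one step of dimension shifting.\<close>

lemma Gorenstein_imp_spliced:
  assumes orth: "\<And>X Y. X \<in> \<C> \<Longrightarrow> Y \<in> \<C> \<Longrightarrow> split_ext A X Y" and M: "M \<in> Gorenstein A \<C>"
  shows "\<exists>K Z f g. spliced A \<C> K Z f g \<and> Z 0 = M"
proof -
  obtain K d m0 where K: "\<And>n :: int. K n \<in> \<C>" and dH: "\<And>n. d n \<in> Hom A (K n) (K (n - 1))"
    and ex: "\<And>n. exact A (d (n + 1)) (d n)"
    and from_ex: "\<And>n. Hom_from_exact A \<C> (d (n + 1)) (d n)"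
    and to_ex: "\<And>n. Hom_to_exact A \<C> (d (n + 1)) (d n)"
    and m0: "is_image A m0 (d 0)" "isomorphic A M (Dom A m0)"
  proof -
    obtain K d m0 where *: "complete_resolution A \<C> K d" "is_image A m0 (d 0)"
      "isomorphic A M (Dom A m0)"
      using M unfolding Gorenstein_iff by blast
    show ?thesis
      using *(1) unfolding complete_resolution_def by (intro that[of K d m0] *(2,3)) simp_all
  qed
  obtain m0' where m0': "is_image A m0' (d 0)" "Dom A m0' = M" using image_isomorphic[OF m0] by blast
  \<comment> \<open>At index zero the image is chosen with source exactly \<open>M\<close>; at other
    indices any image will do.\<close>
  have "\<exists>m. is_image A m (d n) \<and> (n = 0 \<longrightarrow> Dom A m = M)" for n
  proof (cases "n = 0")
    case False
    then show ?thesis using ex[of "n - 1"] unfolding exact_def by auto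
  qed (use m0' in blast)
  then obtain m where m: "\<And>n. is_image A (m n) (d n)" and M0: "Dom A (m 0) = M" by metis
  define Z where "Z n = Dom A (m n)" for n
  have mM: "monic A (m n)" for n using m[of n] kernel_monic unfolding is_image_def by blast
  have mH: "m n \<in> Hom A (Z n) (K (n - 1))" for n
  proof -
    obtain c where c: "is_cokernel A c (d n)" "is_kernel A (m n) c"
      using m[of n] unfolding is_image_def by blast
    then show ?thesis
      using is_kernel_facts(1)[OF c(2)] is_cokernel_facts(1)[OF c(1)] dH[of n] unfolding Z_def by simp
  qed
  have "\<exists>e. epic A e \<and> e \<in> Hom A (K n) (Z n) \<and> m n \<cdot> e = d n" for n
    using image_factorization[OF m dH] unfolding Z_def by blast
  then obtain e where eE: "\<And>n. epic A (e n)" and eH: "\<And>n. e n \<in> Hom A (K n) (Z n)"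
    and me: "\<And>n. m n \<cdot> e n = d n" by metis
  have mH1: "m (n + 1) \<in> Hom A (Z (n + 1)) (K n)" for n using mH[of "n + 1"] by simp
  have dH1: "d (n + 1) \<in> Hom A (K (n + 1)) (K n)" for n using dH[of "n + 1"] by simp
  have s: "ses A (m (n + 1)) (e n) (Z (n + 1)) (K n) (Z n)" for n
  proof -
    obtain m' where m': "is_image A m' (d (n + 1))" "is_kernel A m' (d n)"
      using ex[of n] unfolding exact_def by blast
    have "is_kernel A (m (n + 1)) (m n \<cdot> e n)"
      using image_kernel_unique[OF m m' dH1 dH] me by simp
    then have "is_kernel A (m (n + 1)) (e n)" using kernel_of_monic_comp[OF _ mM mH eH] by blast
    then show ?thesis using sesI_kernel mH1 eH eE by blast
  qed
  have dd: "d n \<cdot> d (n + 1) = Zero A (K (n + 1)) (K (n - 1))" for n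
  proof -
    have "d n \<cdot> d (n + 1) = m n \<cdot> ((e n \<cdot> m (n + 1)) \<cdot> e (n + 1))"
      using mH[of n] eH[of n] mH1[of n] eH[of "n + 1"] by (simp add: me[symmetric] assoc)
    then show ?thesis using ses_facts(4)[OF s[of n]] mH[of n] eH[of "n + 1"] by simp
  qed
  \<comment> \<open>\<open>Z (k + 1)\<close> is the kernel of \<open>e k\<close>, and Ext^1(X,
    \<open>K k\<close>) is zero, so only lifting along \<open>e k\<close> is left. For
    \<open>u\<close> into \<open>Z k\<close>, the map \<open>m k \<cdot> u\<close> is killed by
    \<open>d (k - 1)\<close>, and Hom-exactness at \<open>K (k - 1)\<close> supplies the
    lift.\<close>
  have split_from: "split_ext A X (Z n)" if X: "X \<in> \<C>" for X n
  proof -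
    define k where "k = n - 1"
    have n: "n = k + 1" and k1: "k - 1 + 1 = k" unfolding k_def by simp_all
    show ?thesis unfolding n
    proof (rule split_ext_kernel[OF s[of k] orth[OF X K]])
      fix u assume u: "u \<in> Hom A X (Z k)"
      have "e (k - 1) \<cdot> m k = Zero A (Z k) (Z (k - 1))"
        using ses_facts(4)[OF s[of "k - 1"]] by simp
      then have "d (k - 1) \<cdot> (m k \<cdot> u) = Zero A X (K (k - 1 - 1))"
        using comp_cong_left[of "e (k - 1)" "m k" _ u] u mH[of k] mH[of "k - 1"] eH[of "k - 1"]
        by (simp add: me[symmetric] assoc)
      moreover have "\<forall>X \<in> \<C>. \<forall>v \<in> Hom A X (K (k - 1)). d (k - 1) \<cdot> v = Zero A X (K (k - 1 - 1)) \<longrightarrow>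
          (\<exists>u \<in> Hom A X (K k). d k \<cdot> u = v)"
        using from_ex[of "k - 1"] unfolding Hom_from_exact_iff[OF dH1 dH dd] unfolding k1 .
      moreover have "m k \<cdot> u \<in> Hom A X (K (k - 1))" using u mH[of k] by simp
      ultimately obtain v where v: "v \<in> Hom A X (K k)" "d k \<cdot> v = m k \<cdot> u" using X by blast
      have "m k \<cdot> (e k \<cdot> v) = m k \<cdot> u" using v mH[of k] eH[of k] by (simp add: me[symmetric] assoc)
      then have "e k \<cdot> v = u" using monicD[OF mM, of k "e k \<cdot> v" u] v(1) u mH[of k] eH[of k] by simp
      then show "\<exists>v \<in> Hom A X (K k). e k \<cdot> v = u" using v by blast
    qed
  qed
  \<comment> \<open>Dually, \<open>u \<cdot> e (n + 1)\<close> is killed by the preceding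
    differential, so Hom-exactness at \<open>K (n + 1)\<close> extends \<open>u\<close> to
    \<open>K n\<close>.\<close>
  have split_to: "split_ext A (Z n) X" if X: "X \<in> \<C>" for X n
  proof (rule split_ext_cokernel[OF s[of n] orth[OF K X]])
    fix u assume u: "u \<in> Hom A (Z (n + 1)) X"
    have ue: "u \<cdot> e (n + 1) \<in> Hom A (K (n + 1)) X" using u eH[of "n + 1"] by simp
    have "e (n + 1) \<cdot> m (n + 1 + 1) = Zero A (Z (n + 1 + 1)) (Z (n + 1))"
      using ses_facts(4)[OF s[of "n + 1"]] by simp
    then have "u \<cdot> e (n + 1) \<cdot> d (n + 1 + 1) = Zero A (K (n + 1 + 1)) X"
      using comp_cong_left[of "e (n + 1)" "m (n + 1 + 1)" _ "e (n + 1 + 1)"] u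
        mH1[of "n + 1"] eH[of "n + 1"] eH[of "n + 1 + 1"]
      by (simp add: me[symmetric] assoc)
    moreover have dd1: "d (n + 1) \<cdot> d (n + 1 + 1) = Zero A (K (n + 1 + 1)) (K n)"
      using dd[of "n + 1"] by simp
    have "\<forall>X \<in> \<C>. \<forall>v \<in> Hom A (K (n + 1)) X. v \<cdot> d (n + 1 + 1) = Zero A (K (n + 1 + 1)) X \<longrightarrow>
        (\<exists>u \<in> Hom A (K n) X. u \<cdot> d (n + 1) = v)"
      using to_ex[of "n + 1"] unfolding Hom_to_exact_iff[OF dH1[of n] dH1[of "n + 1"] dd1] .
    ultimately obtain v where v: "v \<in> Hom A (K n) X" "v \<cdot> d (n + 1) = u \<cdot> e (n + 1)"
      using X ue by blast
    have "v \<cdot> m (n + 1) \<cdot> e (n + 1) = u \<cdot> e (n + 1)"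
      using v mH1[of n] eH[of "n + 1"] by (simp add: me[symmetric] assoc)
    then have "v \<cdot> m (n + 1) = u"
      using epicD[OF eE, of "v \<cdot> m (n + 1)" "n + 1" u] v(1) u mH1[of n] eH[of "n + 1"] by simp
    then show "\<exists>v \<in> Hom A (K n) X. v \<cdot> m (n + 1) = u" using v by blast
  qed
  have "spliced A \<C> K Z (\<lambda>n. m (n + 1)) e"
    unfolding spliced_def using K s split_from split_to by blast
  then show ?thesis using M0 unfolding Z_def by blast
qed

text \<open>Moving \<open>Z n\<close> to index zero shows that all the objects \<open>Z n\<close>
  are Gorenstein, not only the one resolved.\<close>

lemma spliced_shift:
  assumes "spliced A \<C> K Z f g"
  shows "spliced A \<C> (\<lambda>n. K (n + k)) (\<lambda>n. Z (n + k)) (\<lambda>n. f (n + k)) (\<lambda>n. g (n + k))"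
proof -
  have *: "n + 1 + k = n + k + 1" for n :: int by simp
  show ?thesis using assms unfolding spliced_def * by blast
qed

section \<open>Totally resolved classes and their closure properties\<close>

lemma left_resolved_op:
  "left_resolved (op_cat A) \<C> \<S> \<longleftrightarrow> (\<forall>M \<in> \<S>. M \<in> Ob A \<and> (\<forall>X \<in> \<C>. split_ext A M X) \<and>
    (\<exists>X \<in> \<C>. \<exists>N \<in> \<S>. \<exists>f g. ses A f g M X N))"
  unfolding left_resolved_def op_unfold_split by blast

text \<open>For \<open>M = Z 0\<close> the neighbours \<open>Z 1\<close> and \<open>Z (- 1)\<close>
  serve as syzygy and cosyzygy.\<close>

lemma Gorenstein_totally_resolved:
  assumes orth: "\<And>X Y. X \<in> \<C> \<Longrightarrow> Y \<in> \<C> \<Longrightarrow> split_ext A X Y"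
  shows "totally_resolved A \<C> (Gorenstein A \<C>)"
proof -
  have "M \<in> Ob A \<and> (\<forall>X \<in> \<C>. split_ext A X M \<and> split_ext A M X) \<and>
    (\<exists>X \<in> \<C>. \<exists>N \<in> Gorenstein A \<C>. \<exists>f g. ses A f g N X M) \<and>
    (\<exists>X \<in> \<C>. \<exists>N \<in> Gorenstein A \<C>. \<exists>f g. ses A f g M X N)" if "M \<in> Gorenstein A \<C>" for M
  proof -
    obtain K Z f g where sp: "spliced A \<C> K Z f g" "Z 0 = M"
      using Gorenstein_imp_spliced[OF orth \<open>M \<in> Gorenstein A \<C>\<close>] by blast
    have Zn: "Z n \<in> Gorenstein A \<C>" for n
      using spliced_imp_Gorenstein[OF spliced_shift[OF sp(1), of n]] by simp
    have K: "K n \<in> \<C>" and s: "ses A (f n) (g n) (Z (n + 1)) (K n) (Z n)"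
      and split: "\<forall>X \<in> \<C>. split_ext A X (Z n) \<and> split_ext A (Z n) X" for n
      using sp(1) unfolding spliced_def by blast+
    have "ses A (f 0) (g 0) (Z 1) (K 0) M" "ses A (f (- 1)) (g (- 1)) M (K (- 1)) (Z (- 1))"
      using s[of 0] s[of "- 1"] sp(2) by simp_all
    moreover have "M \<in> Ob A" using that unfolding Gorenstein_def by blast
    ultimately show ?thesis using K Zn split[of 0] sp(2) by blast
  qed
  then show ?thesis unfolding totally_resolved_def left_resolved_op unfolding left_resolved_def by blast
qed

text \<open>Chosen syzygies and cosyzygies are iterated from \<open>M\<close> in both directions,
  and the resulting short exact sequences are spliced.\<close>

lemma totally_resolved_subset_Gorenstein:
  assumes "totally_resolved A \<C> \<S>"
  shows "\<S> \<subseteq> Gorenstein A \<C>"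
proof
  fix M assume M: "M \<in> \<S>"
  have split: "\<forall>X \<in> \<C>. split_ext A X L \<and> split_ext A L X" if "L \<in> \<S>" for L
    using assms that unfolding totally_resolved_def left_resolved_op unfolding left_resolved_def by blast
  have "\<forall>L \<in> \<S>. \<exists>X N f g. X \<in> \<C> \<and> N \<in> \<S> \<and> ses A f g N X L"
    using assms unfolding totally_resolved_def left_resolved_def by blast
  then obtain sX sN sf sg where
    syz: "\<And>L. L \<in> \<S> \<Longrightarrow> sX L \<in> \<C> \<and> sN L \<in> \<S> \<and> ses A (sf L) (sg L) (sN L) (sX L) L"
    by metis
  have "\<forall>L \<in> \<S>. \<exists>X N f g. X \<in> \<C> \<and> N \<in> \<S> \<and> ses A f g L X N"
    using assms unfolding totally_resolved_def left_resolved_op by blast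
  then obtain tX tN tf tg where
    cosyz: "\<And>L. L \<in> \<S> \<Longrightarrow> tX L \<in> \<C> \<and> tN L \<in> \<S> \<and> ses A (tf L) (tg L) L (tX L) (tN L)"
    by metis
  define Z where "Z n = (if n \<ge> 0 then (sN ^^ nat n) M else (tN ^^ nat (- n)) M)" for n :: int
  \<comment> \<open>For negative \<open>n\<close> the sequence ending in \<open>Z n\<close> is the
    cosyzygy sequence of \<open>Z (n + 1)\<close>, hence the shifted argument. In particular
    \<open>K (- 1)\<close> receives \<open>M\<close>.\<close>
  define K where "K n = (if n \<ge> 0 then sX (Z n) else tX (Z (n + 1)))" for n
  define f where "f n = (if n \<ge> 0 then sf (Z n) else tf (Z (n + 1)))" for n
  define g where "g n = (if n \<ge> 0 then sg (Z n) else tg (Z (n + 1)))" for n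
  have "(sN ^^ k) M \<in> \<S>" "(tN ^^ k) M \<in> \<S>" for k
    using M syz cosyz by (induction k) auto
  then have ZS: "Z n \<in> \<S>" for n unfolding Z_def by simp
  have Z_pos: "Z (n + 1) = sN (Z n)" if "n \<ge> 0" for n
    using that by (simp add: Z_def nat_add_distrib)
  have Z_neg: "Z n = tN (Z (n + 1))" if "n < 0" for n
  proof -
    have "nat (- n) = Suc (nat (- (n + 1)))" using that by simp
    then show ?thesis using that by (auto simp: Z_def)
  qed
  have "spliced A \<C> K Z f g"
    unfolding spliced_def
  proof (intro allI conjI)
    fix n show "K n \<in> \<C>" using syz cosyz ZS unfolding K_def by simp
    show "ses A (f n) (g n) (Z (n + 1)) (K n) (Z n)"
    proof (cases "n \<ge> 0")
      case True
      then show ?thesis using syz[OF ZS[of n]] Z_pos[OF True] unfolding f_def g_def K_def by simp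
    next
      case False
      then show ?thesis using cosyz[OF ZS[of "n + 1"]] Z_neg[of n] unfolding f_def g_def K_def by simp
    qed
    show "\<forall>X \<in> \<C>. split_ext A X (Z n) \<and> split_ext A (Z n) X" using split ZS by blast
  qed
  then have "Z 0 \<in> Gorenstein A \<C>" by (rule spliced_imp_Gorenstein)
  then show "M \<in> Gorenstein A \<C>" unfolding Z_def by simp
qed

text \<open>The horseshoe lemma: \<open>X2 \<rightarrow> N\<close> lifts to \<open>M\<close> because
  Ext^1(X2,L) vanishes, the direct sum of \<open>X1\<close> and \<open>X2\<close> then maps onto
  \<open>M\<close>, and the kernel is an extension of \<open>N'\<close> by \<open>L'\<close>, so it
  lies in the same class.\<close>

lemma left_resolved_extensions:
  assumes res: "left_resolved A \<C> \<S>"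
    and add: "\<And>X Y S. X \<in> \<C> \<Longrightarrow> Y \<in> \<C> \<Longrightarrow> biproduct A X Y S \<Longrightarrow> S \<in> \<C>"
  shows "left_resolved A \<C> {M. \<exists>L \<in> \<S>. \<exists>N \<in> \<S>. \<exists>f g. ses A f g L M N}"
  unfolding left_resolved_def
proof (intro ballI)
  fix M assume "M \<in> {M. \<exists>L \<in> \<S>. \<exists>N \<in> \<S>. \<exists>f g. ses A f g L M N}"
  then obtain L N f g where LN: "L \<in> \<S>" "N \<in> \<S>" and fg: "ses A f g L M N" by blast
  note t = ses_facts[OF fg]
  obtain X1 L' a1 b1 where 1: "X1 \<in> \<C>" "L' \<in> \<S>" "ses A a1 b1 L' X1 L"
    using res LN(1) unfolding left_resolved_def by blast
  obtain X2 N' a2 b2 where 2: "X2 \<in> \<C>" "N' \<in> \<S>" "ses A a2 b2 N' X2 N"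
    using res LN(2) unfolding left_resolved_def by blast
  have split: "split_ext A X L" "split_ext A X N" if "X \<in> \<C>" for X
    using res LN that unfolding left_resolved_def by blast+
  note t1 = ses_facts[OF 1(3)] and t2 = ses_facts[OF 2(3)]
  obtain l where l: "l \<in> Hom A X2 M" "g \<cdot> l = b2"
    using split_ext_lift[OF split(1)[OF 2(1)] fg t2(2)] by blast
  obtain S where S: "biproduct A X1 X2 S" using biproduct_exists t1 t2 by auto
  then obtain i1 i2 p1 p2 where b: "biproduct_maps A X1 X2 S i1 i2 p1 p2"
    unfolding biproduct_iff_maps by blast
  note s = biproduct_maps_typing[OF b] biproduct_maps_simps[OF b]
  have fb: "f \<cdot> b1 \<in> Hom A X1 M" using t t1 by simp
  obtain \<beta> where \<beta>: "\<beta> \<in> Hom A S M" "\<beta> \<cdot> i1 = f \<cdot> b1" "\<beta> \<cdot> i2 = l"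
    using biproduct_copair[OF b fb l(1)] by blast
  have "g \<cdot> \<beta> = b2 \<cdot> p2"
  proof (rule biproduct_copair_eqI[OF b])
    show "g \<cdot> \<beta> \<in> Hom A S N" "b2 \<cdot> p2 \<in> Hom A S N" using \<beta>(1) t(2) t2(2) s(4) by simp_all
    have "g \<cdot> \<beta> \<cdot> i1 = (g \<cdot> f) \<cdot> b1"
      using \<beta>(1,2) s(1) t(1,2) t1(2) by (simp add: assoc)
    also have "\<dots> = b2 \<cdot> p2 \<cdot> i1" using t t1 t2 s by (simp add: assoc)
    finally show "g \<cdot> \<beta> \<cdot> i1 = b2 \<cdot> p2 \<cdot> i1" .
    show "g \<cdot> \<beta> \<cdot> i2 = b2 \<cdot> p2 \<cdot> i2" using \<beta> l s t(2) t2(2) by (simp add: assoc)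
  qed
  from three_by_three[OF biproduct_ses[OF b] fg 1(3) 2(3) \<beta>(1,2) this]
  obtain K a n1 n2 where "ses A a \<beta> K S M" "ses A n1 n2 L' K N'" by blast
  moreover have "S \<in> \<C>" using add 1(1) 2(1) S by blast
  moreover have "split_ext A X M" if "X \<in> \<C>" for X
    using split_ext_extension[OF fg] split that by blast
  moreover have "M \<in> Ob A" using t by simp
  ultimately show "M \<in> Ob A \<and> (\<forall>X \<in> \<C>. split_ext A X M) \<and>
      (\<exists>X \<in> \<C>. \<exists>N \<in> {M. \<exists>L \<in> \<S>. \<exists>N \<in> \<S>. \<exists>f g. ses A f g L M N}. \<exists>f g. ses A f g N X M)"
    using 1(2) 2(2) by blast
qed

text \<open>In \<open>op_cat A\<close> the class of extensions is the same set with the two outer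
  terms exchanged, so the left-hand statement covers both halves.\<close>

lemma totally_resolved_extensions:
  assumes "totally_resolved A \<C> \<S>"
    and add: "\<And>X Y S. X \<in> \<C> \<Longrightarrow> Y \<in> \<C> \<Longrightarrow> biproduct A X Y S \<Longrightarrow> S \<in> \<C>"
  shows "totally_resolved A \<C> {M. \<exists>L \<in> \<S>. \<exists>N \<in> \<S>. \<exists>f g. ses A f g L M N}"
proof -
  have res: "left_resolved A \<C> \<S>" "left_resolved (op_cat A) \<C> \<S>"
    using assms(1) unfolding totally_resolved_def by blast+
  have "{M. \<exists>L \<in> \<S>. \<exists>N \<in> \<S>. \<exists>f g. ses A g f N M L} =
      {M. \<exists>L \<in> \<S>. \<exists>N \<in> \<S>. \<exists>f g. ses A f g L M N}" by blast
  moreover have "left_resolved (op_cat A) \<C> {M. \<exists>L \<in> \<S>. \<exists>N \<in> \<S>. \<exists>f g. ses A g f N M L}"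
    using res(2) add
    by (rule abelian_category.left_resolved_extensions[OF op_abelian, unfolded op_unfold])
  moreover have "left_resolved A \<C> {M. \<exists>L \<in> \<S>. \<exists>N \<in> \<S>. \<exists>f g. ses A f g L M N}"
    using res(1) add by (rule left_resolved_extensions)
  ultimately show ?thesis unfolding totally_resolved_def by argo
qed

text \<open>Each \<open>X\<close> is resolved by its own identity, with the zero object of
  \<open>\<C>\<close> as kernel.\<close>

lemma left_resolved_refl:
  assumes C: "\<C> \<subseteq> Ob A" "Z \<in> \<C>" "zero_object A Z"
    and orth: "\<And>X Y. X \<in> \<C> \<Longrightarrow> Y \<in> \<C> \<Longrightarrow> split_ext A X Y"
  shows "left_resolved A \<C> \<C>"
proof -
  have "ses A (Zero A Z X) (Ident A X) Z X X" if "X \<in> \<C>" for X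
  proof (rule sesI_kernel)
    have ob: "X \<in> Ob A" "Z \<in> Ob A" using that C by auto
    show z: "Zero A Z X \<in> Hom A Z X" and i: "Ident A X \<in> Hom A X X" using ob by simp_all
    show "epic A (Ident A X)" by (rule epicI[OF i]) simp
    show "is_kernel A (Zero A Z X) (Ident A X)"
    proof (rule is_kernelI[OF z i])
      show "monic A (Zero A Z X)"
      proof (rule monicI[OF z])
        fix W u assume u: "u \<in> Hom A W Z"
        then have "W \<in> Ob A" by simp
        then have "\<exists>!f. f \<in> Hom A W Z" using C(3) unfolding zero_object_def by blast
        moreover have "Zero A W Z \<in> Hom A W Z" using ob \<open>W \<in> Ob A\<close> by simp
        ultimately show "u = Zero A W Z" using u by blast
      qed
      show "Ident A X \<cdot> Zero A Z X = Zero A Z X" using ob by simp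
      fix W u assume u: "u \<in> Hom A W X" "Ident A X \<cdot> u = Zero A W X"
      then have "u = Zero A W X" by simp
      then show "\<exists>h \<in> Hom A W Z. Zero A Z X \<cdot> h = u"
        using u ob by (intro bexI[of _ "Zero A W Z"]) simp_all
    qed
  qed
  then show ?thesis using C orth unfolding left_resolved_def by blast
qed

lemma totally_resolved_refl:
  assumes "\<C> \<subseteq> Ob A" "Z \<in> \<C>" "zero_object A Z"
    and "\<And>X Y. X \<in> \<C> \<Longrightarrow> Y \<in> \<C> \<Longrightarrow> split_ext A X Y"
  shows "totally_resolved A \<C> \<C>"
  unfolding totally_resolved_def
  using left_resolved_refl[OF assms]
    abelian_category.left_resolved_refl[OF op_abelian, unfolded op_unfold_split, OF assms] by blast

text \<open>Compose a resolution \<open>Y \<rightarrow> G\<close> with the projection onto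
  \<open>H\<close>. The kernel is an extension of \<open>X\<close> by \<open>N\<close> and thus
  already in \<open>\<S>\<close>, so adding the single object \<open>H\<close> suffices.\<close>

lemma left_resolved_summand:
  assumes res: "left_resolved A \<C> \<S>"
    and ext: "\<And>f g L M N. ses A f g L M N \<Longrightarrow> L \<in> \<S> \<Longrightarrow> N \<in> \<S> \<Longrightarrow> M \<in> \<S>"
    and "\<C> \<subseteq> \<S>" and X: "X \<in> \<C>" and b: "biproduct A H X G" and G: "G \<in> \<S>"
  shows "left_resolved A \<C> (insert H \<S>)"
proof -
  obtain i1 i2 p1 p2 where m: "biproduct_maps A H X G i1 i2 p1 p2"
    using b unfolding biproduct_iff_maps by blast
  note s = biproduct_maps_typing[OF m] biproduct_maps_simps[OF m]
  obtain Y N a c where Y: "Y \<in> \<C>" "N \<in> \<S>" "ses A a c N Y G"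
    using res G unfolding left_resolved_def by blast
  obtain K k u v where K: "ses A k (p1 \<cdot> c) K Y H" "ses A u v N K X"
    using kernel_of_composite[OF Y(3) biproduct_ses[OF biproduct_maps_swap[OF m]]] by blast
  have "K \<in> \<S>" using ext[OF K(2)] Y X \<open>\<C> \<subseteq> \<S>\<close> by blast
  moreover have "split_ext A Z H" if "Z \<in> \<C>" for Z
    using split_ext_summand[OF _ s(1,3,5)] res G that unfolding left_resolved_def by blast
  moreover have "H \<in> Ob A" using s by simp
  ultimately show ?thesis using res Y(1) K(1) unfolding left_resolved_def by blast
qed

lemma totally_resolved_summand:
  assumes res: "totally_resolved A \<C> \<S>"
    and ext: "\<And>f g L M N. ses A f g L M N \<Longrightarrow> L \<in> \<S> \<Longrightarrow> N \<in> \<S> \<Longrightarrow> M \<in> \<S>"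
    and "\<C> \<subseteq> \<S>" "X \<in> \<C>" "biproduct A H X G" "G \<in> \<S>"
  shows "totally_resolved A \<C> (insert H \<S>)"
  unfolding totally_resolved_def
proof
  show "left_resolved A \<C> (insert H \<S>)"
    using res unfolding totally_resolved_def
    by (intro left_resolved_summand[OF _ _ assms(3-6)]) (use ext in blast)+
  \<comment> \<open>Closure under extensions is symmetric in the outer terms, so it also holds in
    the opposite category.\<close>
  show "left_resolved (op_cat A) \<C> (insert H \<S>)"
    using res unfolding totally_resolved_def
    by (intro abelian_category.left_resolved_summand[OF op_abelian, unfolded op_unfold, OF _ _ assms(3-6)])
      (use ext in blast)+
qed

lemma projective_lift:
  assumes "P \<in> projectives A" "ses A f g X Y Z" "u \<in> Hom A P Z"
  shows "\<exists>v \<in> Hom A P Y. g \<cdot> v = u"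
proof -
  have "Dom A g = Y" "Cod A g = Z" using ses_facts(2)[OF assms(2)] by auto
  then show ?thesis using assms(1,3) ses_epic[OF assms(2)] unfolding projectives_def by blast
qed

end

section \<open>Special precovers\<close>

locale gorenstein_category = abelian_category +
  fixes \<C> :: "'a set"
  assumes subcategory: "subcategory A \<C>"
    and Ext_orthogonal: "Ext_orthogonal A \<C> \<C>"
    and generator: "generator A (projectives A) \<C>"
begin

abbreviation \<G> :: "'a set" where "\<G> \<equiv> Gorenstein A \<C>"

section \<open>Closure properties of the Gorenstein subcategory\<close>

lemma C_Ob: "\<C> \<subseteq> Ob A"
  using subcategory unfolding subcategory_def by blast

lemma C_biproduct: "X \<in> \<C> \<Longrightarrow> Y \<in> \<C> \<Longrightarrow> biproduct A X Y S \<Longrightarrow> S \<in> \<C>"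
  using subcategory unfolding subcategory_def by blast

lemma C_split: "X \<in> \<C> \<Longrightarrow> Y \<in> \<C> \<Longrightarrow> split_ext A X Y"
  using Ext_orthogonal Ext_vanishes_1_iff C_Ob unfolding Ext_orthogonal_def by blast

lemma G_totally_resolved: "totally_resolved A \<C> \<G>"
  using Gorenstein_totally_resolved C_split by blast

lemma G_Ob: "\<G> \<subseteq> Ob A"
  unfolding Gorenstein_def by blast

text \<open>The extensions of Gorenstein objects form a totally resolved class, and the Gorenstein
  subcategory contains every such class.\<close>

lemma G_extension: "ses A f g L M N \<Longrightarrow> L \<in> \<G> \<Longrightarrow> N \<in> \<G> \<Longrightarrow> M \<in> \<G>"
  using totally_resolved_subset_Gorenstein[OF totally_resolved_extensions[OF G_totally_resolved]]
    C_biproduct by blast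

lemma C_subset_G: "\<C> \<subseteq> \<G>"
proof -
  obtain Z where "Z \<in> \<C>" "zero_object A Z" using subcategory unfolding subcategory_def by blast
  then show ?thesis
    using totally_resolved_subset_Gorenstein[OF totally_resolved_refl[OF C_Ob]] C_split by blast
qed

lemma G_stable_summand:
  assumes "X \<in> \<C>" "biproduct A H X G" "G \<in> \<G>"
  shows "H \<in> \<G>"
proof -
  have "totally_resolved A \<C> (insert H \<G>)"
    by (rule totally_resolved_summand[OF G_totally_resolved _ C_subset_G assms]) (rule G_extension)
  then show ?thesis using totally_resolved_subset_Gorenstein by blast
qed

text \<open>Cover the term \<open>X\<close> of a resolution of \<open>G\<close> by a projective with
  kernel in \<open>\<C>\<close>. The kernel of the composite onto \<open>G\<close> is an extension
  of \<open>G'\<close> by that kernel, hence Gorenstein.\<close>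

lemma G_projective_syzygy:
  assumes "G \<in> \<G>"
  shows "\<exists>P \<in> projectives A. \<exists>N \<in> \<G>. \<exists>f g. ses A f g N P G"
proof -
  obtain X G' a b where X: "X \<in> \<C>" "G' \<in> \<G>" "ses A a b G' X G"
    using G_totally_resolved assms unfolding totally_resolved_def left_resolved_def by blast
  obtain c p where cp: "short_exact A c p" "Cod A p = X" "Dom A p \<in> projectives A" "Dom A c \<in> \<C>"
    using generator X(1) unfolding generator_def by blast
  have "c \<in> Mor A" "p \<in> Mor A" "Cod A c = Dom A p"
    using cp(1) unfolding short_exact_def exact_def by blast+
  then have "ses A c p (Dom A c) (Dom A p) X"
    using short_exact_ses[OF cp(1)] cp(2) Dom_closed Cod_closed by auto
  from kernel_of_composite[OF this X(3)] obtain K k u v where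
    "ses A k (b \<cdot> p) K (Dom A p) G" "ses A u v (Dom A c) K G'" by blast
  moreover from this have "K \<in> \<G>" using G_extension C_subset_G cp(4) X(2) by blast
  ultimately show ?thesis using cp(3) by blast
qed

text \<open>Maps from a Gorenstein \<open>X\<close> lift along \<open>f\<close> because Ext^1(X,K)
  vanishes, which yields the precover condition from the sequence alone.\<close>

lemma SPC_iff:
  "M \<in> SPC A \<G> \<longleftrightarrow> (\<exists>k f K G. ses A k f K G M \<and> G \<in> \<G> \<and> (\<forall>X \<in> \<G>. split_ext A X K))"
proof
  assume "M \<in> SPC A \<G>"
  then obtain f k where "M \<in> Ob A" "precover A \<G> f M" "epic A f" "is_kernel A k f"
    and K: "Dom A k \<in> right_Ext1_perp A \<G>"
    unfolding SPC_def special_precover_def by blast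
  then have f: "f \<in> Hom A (Dom A f) M" "Dom A f \<in> \<G>" and k: "k \<in> Hom A (Dom A k) (Dom A f)"
    using G_Ob is_kernel_facts(1)[of k f] unfolding precover_def by auto
  have "ses A k f (Dom A k) (Dom A f) M"
    using sesI_kernel k f(1) \<open>epic A f\<close> \<open>is_kernel A k f\<close> by blast
  moreover have "\<forall>X \<in> \<G>. split_ext A X (Dom A k)"
    using K Ext_vanishes_1_iff G_Ob unfolding right_Ext1_perp_def by blast
  ultimately show "\<exists>k f K G. ses A k f K G M \<and> G \<in> \<G> \<and> (\<forall>X \<in> \<G>. split_ext A X K)"
    using f(2) by blast
next
  assume "\<exists>k f K G. ses A k f K G M \<and> G \<in> \<G> \<and> (\<forall>X \<in> \<G>. split_ext A X K)"
  then obtain k f K G where s: "ses A k f K G M" and G: "G \<in> \<G>"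
    and K: "\<forall>X \<in> \<G>. split_ext A X K" by blast
  note t = ses_facts[OF s]
  have "(\<lambda>u. f \<cdot> u) ` Hom A X G = Hom A X M" if "X \<in> \<G>" for X
  proof
    show "(\<lambda>u. f \<cdot> u) ` Hom A X G \<subseteq> Hom A X M" using t(2) Comp_closed by blast
    show "Hom A X M \<subseteq> (\<lambda>u. f \<cdot> u) ` Hom A X G"
      using split_ext_lift[OF _ s] K that by blast
  qed
  moreover have ty: "f \<in> Mor A" "Cod A f = M" "Dom A f = G" "Dom A k = K" "M \<in> Ob A" "K \<in> Ob A"
    using t by auto
  ultimately have "precover A \<G> f M" using G unfolding precover_def by simp
  moreover have "Dom A k \<in> right_Ext1_perp A \<G>"
    using K Ext_vanishes_1_iff G_Ob ty unfolding right_Ext1_perp_def by blast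
  ultimately show "M \<in> SPC A \<G>"
    using t(5) ses_epic[OF s] ty unfolding SPC_def special_precover_def by blast
qed

lemma SPC_extension:
  assumes fg: "ses A f g X Y Z" and X: "X \<in> SPC A \<G>" and Z: "Z \<in> SPC A \<G>"
  shows "Y \<in> SPC A \<G>"
proof -
  obtain kX p KX GX where 1: "ses A kX p KX GX X" "GX \<in> \<G>" "\<forall>W \<in> \<G>. split_ext A W KX"
    using X unfolding SPC_iff by blast
  obtain kZ q KZ GZ where 2: "ses A kZ q KZ GZ Z" "GZ \<in> \<G>" "\<forall>W \<in> \<G>. split_ext A W KZ"
    using Z unfolding SPC_iff by blast
  obtain P N j r where P: "P \<in> projectives A" "N \<in> \<G>" "ses A j r N P GZ"
    using G_projective_syzygy[OF 2(2)] by blast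
  note t = ses_facts[OF fg] and t1 = ses_facts[OF 1(1)] and t2 = ses_facts[OF 2(1)]
    and tP = ses_facts[OF P(3)]
  have "q \<cdot> r \<in> Hom A P Z" using t2(2) tP(2) by simp
  \<comment> \<open>Lifting \<open>GZ \<rightarrow> Z\<close> to \<open>Y\<close> itself may be
    obstructed; after restriction to the projective \<open>P\<close> it is possible.\<close>
  then obtain l where l: "l \<in> Hom A P Y" "g \<cdot> l = q \<cdot> r" using projective_lift[OF P(1) fg] by blast
  have lj: "l \<cdot> j \<in> Hom A N Y" using l tP(1) by simp
  have "g \<cdot> (l \<cdot> j) = q \<cdot> (r \<cdot> j)"
    using comp_cong_left[OF l(2), of j] assoc[of j r q] l(1) t(2) t2(2) tP(1,2) by simp
  then have "g \<cdot> (l \<cdot> j) = Zero A N Z" using tP(1,2,4) t2(2) by simp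
  then obtain m where m: "m \<in> Hom A N X" "f \<cdot> m = l \<cdot> j" using ses_lift[OF fg lj] by blast
  \<comment> \<open>\<open>N\<close> is Gorenstein, so maps from it lift along the precover
    \<open>p\<close> of \<open>X\<close>.\<close>
  obtain n where n: "n \<in> Hom A N GX" "p \<cdot> n = m"
    using split_ext_lift[OF _ 1(1) m(1)] 1(3) P(2) by blast
  \<comment> \<open>The pushout repairs the passage from \<open>GZ\<close> to \<open>P\<close>: it
    is again an extension of \<open>GZ\<close>, now by \<open>GX\<close>.\<close>
  obtain E e \<iota> \<rho> where E: "ses A \<iota> \<rho> GX E GZ" "e \<in> Hom A P E" "\<rho> \<cdot> e = r" "e \<cdot> j = \<iota> \<cdot> n"
    and univ: "\<And>T u v. u \<in> Hom A GX T \<Longrightarrow> v \<in> Hom A P T \<Longrightarrow> u \<cdot> n = v \<cdot> j \<Longrightarrow>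
      \<exists>w \<in> Hom A E T. w \<cdot> \<iota> = u \<and> w \<cdot> e = v"
    and uniq: "\<And>T w w'. w \<in> Hom A E T \<Longrightarrow> w' \<in> Hom A E T \<Longrightarrow> w \<cdot> \<iota> = w' \<cdot> \<iota> \<Longrightarrow>
      w \<cdot> e = w' \<cdot> e \<Longrightarrow> w = w'"
    using pushout_ses[OF P(3) n(1)] by metis
  note tE = ses_facts[OF E(1)]
  have "f \<cdot> p \<in> Hom A GX Y" "f \<cdot> p \<cdot> n = l \<cdot> j" using t(1) t1(2) n m(2) by (simp_all add: assoc)
  \<comment> \<open>The maps \<open>f \<cdot> p\<close> on \<open>GX\<close> and \<open>l\<close> on
    \<open>P\<close> agree on \<open>N\<close>, so they glue to a map on the pushout. It is
    compatible with both precovers, as the nine lemma requires.\<close>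
  then obtain \<beta> where \<beta>: "\<beta> \<in> Hom A E Y" "\<beta> \<cdot> \<iota> = f \<cdot> p" "\<beta> \<cdot> e = l" using univ l(1) by blast
  have "g \<cdot> \<beta> = q \<cdot> \<rho>"
  proof (rule uniq)
    show "g \<cdot> \<beta> \<in> Hom A E Z" "q \<cdot> \<rho> \<in> Hom A E Z" using \<beta>(1) t(2) t2(2) tE(2) by simp_all
    have "g \<cdot> \<beta> \<cdot> \<iota> = (g \<cdot> f) \<cdot> p" using \<beta>(1,2) t(1,2) t1(2) tE(1) by (simp add: assoc)
    also have "\<dots> = q \<cdot> \<rho> \<cdot> \<iota>" using t t1(2) t2(2) tE by (simp add: assoc)
    finally show "g \<cdot> \<beta> \<cdot> \<iota> = q \<cdot> \<rho> \<cdot> \<iota>" .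
    show "g \<cdot> \<beta> \<cdot> e = q \<cdot> \<rho> \<cdot> e" using \<beta>(1,3) l(2) E(2,3) t(2) t2(2) tE(2) by (simp add: assoc)
  qed
  from three_by_three[OF E(1) fg 1(1) 2(1) \<beta>(1,2) this]
  obtain K a n1 n2 where K: "ses A a \<beta> K E Y" "ses A n1 n2 KX K KZ" by blast
  have "E \<in> \<G>" using G_extension[OF E(1)] 1(2) 2(2) by blast
  moreover have "\<forall>W \<in> \<G>. split_ext A W K" using split_ext_extension[OF K(2)] 1(3) 2(3) by blast
  ultimately show ?thesis using K(1) unfolding SPC_iff by blast
qed

text \<open>
  The inclusion of \<open>C\<close> lifts along the precover \<open>G\<close> of the direct sum \<open>S\<close>, because \<open>C\<close> itself is
  Gorenstein. So \<open>G\<close> splits as \<open>H\<close> plus \<open>C\<close>, and \<open>H \<rightarrow> X\<close> has the same kernel as \<open>G \<rightarrow> S\<close>.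
\<close>

lemma SPC_stable_summand:
  assumes C: "C \<in> \<C>" and b: "biproduct A X C S" and S: "S \<in> SPC A \<G>"
  shows "X \<in> SPC A \<G>"
proof -
  obtain k f K G where s: "ses A k f K G S" "G \<in> \<G>" "\<forall>W \<in> \<G>. split_ext A W K"
    using S unfolding SPC_iff by blast
  obtain i1 i2 p1 p2 where m: "biproduct_maps A X C S i1 i2 p1 p2"
    using b unfolding biproduct_iff_maps by blast
  note t = ses_facts[OF s(1)] and bt = biproduct_maps_typing[OF m] and bs = biproduct_maps_simps[OF m]
  obtain \<sigma> where \<sigma>: "\<sigma> \<in> Hom A C G" "f \<cdot> \<sigma> = i2"
    using split_ext_lift[OF _ s(1) bt(2)] s(3) C C_subset_G by blast
  obtain H h u v where H: "ses A h (p2 \<cdot> f) H G C" "ses A u v K H X"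
    using kernel_of_composite[OF s(1) biproduct_ses[OF m]] by blast
  have "p2 \<cdot> f \<cdot> \<sigma> = Ident A C" using \<sigma> t(2) bt(4) bs(2) by (simp add: assoc)
  from section_biproduct[OF H(1) \<sigma>(1) this]
  have "biproduct A H C G" using ses_facts(1,2)[OF H(1)] unfolding biproduct_iff_maps by auto
  then have "H \<in> \<G>" using G_stable_summand C s(2) by blast
  then show ?thesis using H(2) s(3) unfolding SPC_iff by blast
qed

end

theorem theorem4p3:
  fixes A :: "('o, 'm, 'z) precat_scheme" and \<C> :: "'o set"
  assumes "abelian_category A"
    and "subcategory A \<C>"
    and "Ext_orthogonal A \<C> \<C>"
    and "generator A (projectives A) \<C>"
  shows "closed_under_extensions A (SPC A (Gorenstein A \<C>)) \<and>
    closed_under_stable_summands A \<C> (SPC A (Gorenstein A \<C>))"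
proof -
  interpret gorenstein_category A \<C>
    using assms by (intro gorenstein_category.intro gorenstein_category_axioms.intro)
  have "Cod A f \<in> SPC A \<G>"
    if "short_exact A f g" "Dom A f \<in> SPC A \<G>" "Cod A g \<in> SPC A \<G>" for f g
  proof -
    have "f \<in> Mor A" "g \<in> Mor A" "Cod A f = Dom A g"
      using that(1) unfolding short_exact_def exact_def by blast+
    then have "ses A f g (Dom A f) (Cod A f) (Cod A g)"
      using short_exact_ses[OF that(1)] Dom_closed Cod_closed by simp
    then show ?thesis using SPC_extension that(2,3) by blast
  qed
  then show ?thesis
    unfolding closed_under_extensions_def closed_under_stable_summands_def
    using SPC_stable_summand by blast
qed

end
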